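(* Let $\mathcal A=\{a_1,\ldots,a_n\}\subset\mathbb N^m$ be a list of nonzero vectors such that $I_{\mathcal A}$ is a complete intersection, and suppose that for some $1\le i<j\le n$ we have $a_i\in\mathrm{Cone}(\mathcal A\setminus\{a_i\})$, $a_j\in\mathrm{Cone}(\mathcal A\setminus\{a_j\})$ and $m_ia_i=m_ja_j$. Define $\mathcal A'=\{a'_1,\ldots,a'_{n-1}\}$ by $a'_r:=a_r$ for $r\in\{1,\ldots,j-1\}\setminus\{i\}$, $a'_r:=a_{r+1}$ for $r\in\{j,\ldots,n-1\}$, and $a'_i:=\gcd\{a_i,a_j\}$. Then: (1) $I_{\mathcal A'}$ is a complete intersection; (2) for every $r$ with $a'_r\in\mathrm{Cone}(\mathcal A'\setminus\{a'_r\})$, setting $m'_r:=\min\{b\in\mathbb Z^+ : b\,a'_r\in\sum_{t\in\{1,\ldots,n-1\},t\neq r}\mathbb N a'_t\}$, one has $m'_r=m_r$ if $r\in\{1,\ldots,j-1\}\setminus\{i\}$ and $m'_r=m_{r+1}$ if $r\in\{j,\ldots,n-1\}$.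
   Context: $k$ is an arbitrary field. For a finite list $\mathcal A=\{a_1,\ldots,a_n\}$ of nonzero vectors in $\mathbb N^m$, the toric ideal $I_{\mathcal A}\subset k[x_1,\ldots,x_n]$ is the kernel of the $k$-algebra homomorphism $x_i\mapsto t^{a_i}=t_1^{a_{i1}}\cdots t_m^{a_{im}}$ into $k[t_1,\ldots,t_m]$; its height is $n-\mathrm{rk}(\mathbb Z\mathcal A)$. An ideal is a complete intersection if its minimal number of generators equals its height. For a finite $\mathcal B\subset\mathbb N^m$, $\mathrm{Cone}(\mathcal B)$ is the set of nonnegative real linear combinations of elements of $\mathcal B$. Whenever $a_i\in\mathrm{Cone}(\mathcal A\setminus\{a_i\})$, $m_i:=\min\{b\in\mathbb Z^+ : b\,a_i\in\sum_{j\neq i}\mathbb N a_j\}$. For $a,b\in\mathbb N^m$ with $a=\lambda b$ for some $\lambda\in\mathbb Q$, $\gcd\{a,b\}\in\mathbb N^m$ is the vector whose $l$-th coordinate is $0$ if $a_l=b_l=0$ and $\gcd\{a_l,b_l\}$ otherwise. *)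

theory Defs
  imports Complex_Main "HOL-Library.Poly_Mapping"
begin

type_synonym 'k mpoly = "(nat \<Rightarrow>\<^sub>0 nat) \<Rightarrow>\<^sub>0 'k"

(* A list A = [a_0,...,a_{n-1}] of vectors of N^m (each a nat list of length m);
   indices are 0-based. *)

definition poly_ring :: "nat \<Rightarrow> 'k::comm_ring_1 mpoly set" where
  "poly_ring n = {p :: 'k mpoly. \<forall>\<mu>\<in>Poly_Mapping.keys p. Poly_Mapping.keys \<mu> \<subseteq> {..<n}}"

definition toric_exp :: "nat list list \<Rightarrow> (nat \<Rightarrow>\<^sub>0 nat) \<Rightarrow> (nat \<Rightarrow>\<^sub>0 nat)" where
  "toric_exp A \<mu> = (\<Sum>i<length A. \<Sum>l<length (A!i). Poly_Mapping.single l (Poly_Mapping.lookup \<mu> i * (A!i!l)))"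

(* the k-algebra homomorphism x_i \<mapsto> t^{a_i} *)
definition toric_hom :: "nat list list \<Rightarrow> 'k::comm_ring_1 mpoly \<Rightarrow> 'k mpoly" where
  "toric_hom A p = (\<Sum>\<mu>\<in>Poly_Mapping.keys p. Poly_Mapping.single (toric_exp A \<mu>) (Poly_Mapping.lookup p \<mu>))"

definition toric_ideal :: "nat list list \<Rightarrow> 'k::comm_ring_1 mpoly set" where
  "toric_ideal A = {p \<in> poly_ring (length A). toric_hom A p = 0}"

definition gen_ideal :: "nat \<Rightarrow> 'k::comm_ring_1 mpoly set \<Rightarrow> 'k mpoly set" where
  "gen_ideal n G = {(\<Sum>g\<in>G. c g * g) | c. \<forall>g\<in>G. c g \<in> poly_ring n}"

definition min_num_gens :: "nat \<Rightarrow> 'k::comm_ring_1 mpoly set \<Rightarrow> nat" where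
  "min_num_gens n I = (LEAST k. \<exists>G. finite G \<and> G \<subseteq> poly_ring n \<and> card G = k \<and> gen_ideal n G = I)"

definition lin_indep_Q :: "nat \<Rightarrow> nat list list \<Rightarrow> nat set \<Rightarrow> bool" where
  "lin_indep_Q m A S = (\<forall>c::nat \<Rightarrow> rat.
      (\<forall>l<m. (\<Sum>i\<in>S. c i * of_nat (A!i!l)) = 0) \<longrightarrow> (\<forall>i\<in>S. c i = 0))"

definition lattice_rank :: "nat \<Rightarrow> nat list list \<Rightarrow> nat" where
  "lattice_rank m A = Max {card S | S. S \<subseteq> {..<length A} \<and> lin_indep_Q m A S}"

(* height of I_A, as given in the context: n - rk(ZA) *)
definition toric_height :: "nat \<Rightarrow> nat list list \<Rightarrow> nat" where
  "toric_height m A = length A - lattice_rank m A"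

definition toric_CI :: "'k::field itself \<Rightarrow> nat \<Rightarrow> nat list list \<Rightarrow> bool" where
  "toric_CI _ m A \<longleftrightarrow> min_num_gens (length A) (toric_ideal A :: 'k mpoly set) = toric_height m A"

definition in_cone :: "nat \<Rightarrow> nat list list \<Rightarrow> nat \<Rightarrow> bool" where
  "in_cone m A i = (\<exists>c::nat \<Rightarrow> real. (\<forall>j. c j \<ge> 0) \<and>
      (\<forall>l<m. real (A!i!l) = (\<Sum>j\<in>{..<length A} - {i}. c j * real (A!j!l))))"

definition in_semigroup_others :: "nat \<Rightarrow> nat list list \<Rightarrow> nat \<Rightarrow> nat list \<Rightarrow> bool" where
  "in_semigroup_others m A i v = (\<exists>c::nat \<Rightarrow> nat.
      \<forall>l<m. v!l = (\<Sum>j\<in>{..<length A} - {i}. c j * (A!j!l)))"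

definition mult_m :: "nat \<Rightarrow> nat list list \<Rightarrow> nat \<Rightarrow> nat" where
  "mult_m m A i = (LEAST b. b > 0 \<and> in_semigroup_others m A i (map ((*) b) (A!i)))"

(* componentwise gcd (gcd 0 0 = 0) *)
definition gcd_vec :: "nat list \<Rightarrow> nat list \<Rightarrow> nat list" where
  "gcd_vec a b = map2 gcd a b"

definition merge_list :: "nat list list \<Rightarrow> nat \<Rightarrow> nat \<Rightarrow> nat list list" where
  "merge_list A i j = map (\<lambda>r. if r = i then gcd_vec (A!i) (A!j)
                               else if r < j then A!r else A!(Suc r)) [0..<length A - 1]"

end

theory Submission
  imports Defs "HOL-Library.Product_Plus"
begin

text \<open>
  Minimal generators of \<open>I\<^sub>A\<close> can be taken to be binomials, so being a complete intersection means that the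
  congruence \<open>A u = A v\<close> on \<open>\<nat>\<^sup>n\<close> is generated by \<open>n - rk A\<close> pairs. The differences of these pairs form a
  matrix which is dominating: no \<open>t\<close> columns carry \<open>t\<close> rows that have both signs on them. Conversely, if a
  family of integer vectors is dominating, the moves along it connect any two points of \<open>\<nat>\<^sup>n\<close> whose
  difference lies in the lattice it spans.

  From \<open>m\<^sub>i a\<^sub>i = m\<^sub>j a\<^sub>j\<close> it follows that \<open>m\<^sub>i\<close> and \<open>m\<^sub>j\<close> are coprime and that the monomials of
  \<open>x\<^sub>i\<^bsup>m\<^sub>i\<^esup> - x\<^sub>j\<^bsup>m\<^sub>j\<^esup>\<close> are isolated in their fiber, so this binomial may be chosen as a generator. Replacing
  the columns \<open>i\<close> and \<open>j\<close> by the single column \<open>m\<^sub>j z\<^sub>i + m\<^sub>i z\<^sub>j\<close> kills its row, and the other rows remain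
  dominating and span the lattice of \<open>A'\<close>. A generator of \<open>I\<^bsub>A'\<^esub>\<close> involving a pure power \<open>x\<^sub>r\<^sup>b\<close> with
  \<open>b = m'\<^sub>r\<close> comes from a row that does not have both signs on \<open>{i, j}\<close>, which gives \<open>m\<^sub>r = b\<close>.
\<close>

subsection \<open>Linear systems\<close>

text \<open>Write p = m_j, q = m_i and g = gcd{a_i, a_j}. In general g lies in the group generated
  by a_i and a_j but not in the semigroup, so a monomial containing the new variable need not come
  from a monomial in x_i and x_j, and a walk in a fiber of A' cannot be lifted step by step.
  Relations do lift, because p and q are coprime. Hence the monomials of the generators are
  discarded and only their differences are kept; domination then restores the walks, with the
  positive and negative parts of the merged differences as new generators. The difference d1 of
  x_i^q - x_j^p is mixed on {i, j}, and this is used twice: its removal makes up for the column lost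
  in merging when domination is checked again, and it rules out any second row mixed on {i, j},
  which is what controls the multiples m_r.\<close>

lemma homogeneous_system_nontrivial:
  fixes \<phi> :: "'a \<Rightarrow> 'b \<Rightarrow> 'k::field"
  assumes "finite Y" "finite X" "card Y < card X"
  shows "\<exists>c. (\<exists>x\<in>X. c x \<noteq> 0) \<and> (\<forall>y\<in>Y. (\<Sum>x\<in>X. c x * \<phi> x y) = 0)"
  using assms
proof (induction Y arbitrary: X \<phi> rule: finite_induct)
  case empty
  then show ?case by (intro exI[of _ "\<lambda>_. 1"]) (auto simp: card_gt_0_iff)
next
  case (insert y Y)
  show ?case
  proof (cases "\<forall>x\<in>X. \<phi> x y = 0")
    case True
    with insert.IH[of X \<phi>] insert.prems insert.hyps show ?thesis by auto
  next
    case False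
    then obtain x0 where x0: "x0 \<in> X" "\<phi> x0 y \<noteq> 0" by auto
    \<comment> \<open>Elimination with pivot \<open>x0\<close>: every \<open>\<psi> x\<close>
      vanishes at \<open>y\<close>, and the coefficient of \<open>x0\<close> is recovered afterwards
      from the equation at \<open>y\<close>.\<close>
    define \<psi> where "\<psi> x z = \<phi> x z - \<phi> x y / \<phi> x0 y * \<phi> x0 z" for x z
    have "card Y < card (X - {x0})" using insert x0 by auto
    with insert.IH[of "X - {x0}" \<psi>] insert.prems obtain c x1 where
      c: "x1 \<in> X - {x0}" "c x1 \<noteq> 0" "\<And>z. z \<in> Y \<Longrightarrow> (\<Sum>x\<in>X-{x0}. c x * \<psi> x z) = 0" by auto
    define s where "s = (\<Sum>x\<in>X-{x0}. c x * \<phi> x y)"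
    define c' where "c' = c(x0 := - s / \<phi> x0 y)"
    have eq: "(\<Sum>x\<in>X. c' x * \<phi> x z) = (\<Sum>x\<in>X-{x0}. c x * \<phi> x z) - s / \<phi> x0 y * \<phi> x0 z" for z
    proof -
      have "(\<Sum>x\<in>X. c' x * \<phi> x z) = c' x0 * \<phi> x0 z + (\<Sum>x\<in>X-{x0}. c' x * \<phi> x z)"
        using insert.prems x0 by (simp add: sum.remove)
      moreover have "(\<Sum>x\<in>X-{x0}. c' x * \<phi> x z) = (\<Sum>x\<in>X-{x0}. c x * \<phi> x z)"
        by (rule sum.cong) (auto simp: c'_def)
      ultimately show ?thesis by (simp add: c'_def)
    qed
    have eq2: "(\<Sum>x\<in>X-{x0}. c x * \<psi> x z) = (\<Sum>x\<in>X-{x0}. c x * \<phi> x z) - s / \<phi> x0 y * \<phi> x0 z" for z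
      by (simp add: \<psi>_def s_def right_diff_distrib sum_subtractf sum_distrib_right sum_divide_distrib
          mult.assoc)
    have "(\<Sum>x\<in>X. c' x * \<phi> x z) = 0" if "z \<in> insert y Y" for z
    proof (cases "z = y")
      case True
      then show ?thesis using eq[of y] x0 by (simp add: s_def)
    next
      case False
      then show ?thesis using that c(3)[of z] eq[of z] eq2[of z] by auto
    qed
    moreover have "x1 \<in> X" "c' x1 \<noteq> 0" using c by (auto simp: c'_def)
    ultimately show ?thesis by blast
  qed
qed

text \<open>The right-hand side is adjoined as one more vector, indexed by \<open>None\<close>.
  There are then more vectors than coordinates, so a dependency exists; independence of the others
  forces a nonzero coefficient at \<open>None\<close>, and dividing by it solves the system.\<close>

lemma independent_square_system_solvable:
  fixes \<phi> :: "'a \<Rightarrow> 'b \<Rightarrow> 'k::field"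
  assumes "finite T" "finite U" "card U \<le> card T"
    and indep: "\<And>c. \<forall>l\<in>U. (\<Sum>d\<in>T. c d * \<phi> d l) = 0 \<Longrightarrow> \<forall>d\<in>T. c d = 0"
  shows "\<exists>c. \<forall>l\<in>U. (\<Sum>d\<in>T. c d * \<phi> d l) = y l"
proof -
  define \<psi> where "\<psi> = (\<lambda>x l. case x of None \<Rightarrow> y l | Some d \<Rightarrow> \<phi> d l)"
  let ?X = "insert None (Some ` T)"
  have X: "finite ?X" "card U < card ?X"
    using assms by (auto simp: card_insert_if card_image)
  from homogeneous_system_nontrivial[OF assms(2) X, of \<psi>] obtain c where
    c: "\<exists>x\<in>?X. c x \<noteq> 0" "\<And>l. l \<in> U \<Longrightarrow> (\<Sum>x\<in>?X. c x * \<psi> x l) = 0" by auto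
  have split: "(\<Sum>x\<in>?X. c x * \<psi> x l) = c None * y l + (\<Sum>d\<in>T. c (Some d) * \<phi> d l)" for l
    using assms(1) by (simp add: \<psi>_def sum.reindex)
  have "c None \<noteq> 0"
  proof
    assume "c None = 0"
    then have "\<forall>d\<in>T. c (Some d) = 0"
      using indep[of "\<lambda>d. c (Some d)"] c(2) split by simp
    then show False using c(1) \<open>c None = 0\<close> by auto
  qed
  have "(\<Sum>d\<in>T. (- c (Some d) / c None) * \<phi> d l) = y l" if "l \<in> U" for l
  proof -
    have "(\<Sum>d\<in>T. (- c (Some d) / c None) * \<phi> d l) = - (\<Sum>d\<in>T. c (Some d) * \<phi> d l) / c None"
      by (simp add: sum_divide_distrib sum_negf)
    also have "\<dots> = y l"
      using c(2)[OF that] split[of l] \<open>c None \<noteq> 0\<close> by (simp add: field_simps add_eq_0_iff)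
    finally show ?thesis .
  qed
  then show ?thesis by (intro exI[of _ "\<lambda>d. - c (Some d) / c None"]) blast
qed

lemma common_denominator:
  fixes c :: "'a \<Rightarrow> rat"
  assumes "finite T"
  shows "\<exists>N::int. N > 0 \<and> (\<exists>k::'a \<Rightarrow> int. \<forall>d\<in>T. of_int (k d) = of_int N * c d)"
  using assms
proof (induction T rule: finite_induct)
  case empty
  show ?case by (intro exI[of _ 1]) auto
next
  case (insert x T)
  then obtain N k where N: "N > 0" "\<forall>d\<in>T. of_int (k d) = of_int N * c d" by auto
  obtain a b where ab: "c x = of_int a / of_int b" "b > 0"
    by (cases "c x") (auto simp: Fract_of_int_quotient)
  let ?k = "\<lambda>d. if d = x then N * a else b * k d"
  have "N * b > 0" "\<forall>d\<in>insert x T. of_int (?k d) = of_int (N * b) * c d"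
    using N ab insert.hyps by auto
  then show ?case by (intro exI[of _ "N * b"] conjI exI[of _ ?k])
qed

subsection \<open>Moves and dominating families\<close>

text \<open>A pair \<open>(a, b)\<close> stands for the binomial x^a - x^b, used in either
  direction; \<open>w\<close> is the monomial that multiplies it.\<close>

definition moves :: "('a::comm_monoid_add \<times> 'a) set \<Rightarrow> 'a \<Rightarrow> 'a \<Rightarrow> bool" where
  "moves B x y \<longleftrightarrow> (\<exists>a b w. ((a, b) \<in> B \<or> (b, a) \<in> B) \<and> x = a + w \<and> y = b + w)"

definition conn :: "('a::comm_monoid_add \<times> 'a) set \<Rightarrow> 'a \<Rightarrow> 'a \<Rightarrow> bool" where
  "conn B = (moves B)\<^sup>*\<^sup>*"

lemma moves_sym: "moves B x y \<Longrightarrow> moves B y x"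
  unfolding moves_def by blast

lemma conn_refl [simp]: "conn B x x"
  by (simp add: conn_def)

lemma conn_trans: "conn B x y \<Longrightarrow> conn B y z \<Longrightarrow> conn B x z"
  unfolding conn_def by simp

lemma conn_sym: "conn B x y \<Longrightarrow> conn B y x"
  unfolding conn_def
  by (rule sympD[OF sympI[THEN symp_rtranclp]]) (rule moves_sym)

lemma moves_conn: "moves B x y \<Longrightarrow> conn B x y"
  unfolding conn_def by simp

lemma pair_conn: "(a, b) \<in> B \<Longrightarrow> conn B a b"
  by (rule moves_conn) (metis add_0_right moves_def)

lemma moves_add: "moves B x y \<Longrightarrow> moves B (x + z) (y + z)"
  unfolding moves_def by (metis add.assoc)

lemma conn_add: "conn B x y \<Longrightarrow> conn B (x + z) (y + z)"
  unfolding conn_def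
  by (induction rule: rtranclp_induct) (simp, rule rtranclp.rtrancl_into_rtrancl, assumption, rule moves_add)

lemma conn_induct [consumes 1, case_names refl step]:
  assumes "conn B x y" "P x" "\<And>y z. conn B x y \<Longrightarrow> P y \<Longrightarrow> moves B y z \<Longrightarrow> P z"
  shows "P y"
  using assms unfolding conn_def by (rule rtranclp_induct)

lemma conn_isolated:
  assumes "conn B x y" "\<And>z. moves B x z \<Longrightarrow> z = x"
  shows "y = x"
  using assms(1) by (induction rule: conn_induct) (use assms(2) in auto)

type_synonym mono = "nat \<Rightarrow>\<^sub>0 nat"

definition mons :: "nat \<Rightarrow> mono set" where
  "mons n = {\<mu>. Poly_Mapping.keys \<mu> \<subseteq> {..<n}}"

lemma mons_iff: "\<mu> \<in> mons n \<longleftrightarrow> (\<forall>l\<ge>n. Poly_Mapping.lookup \<mu> l = 0)"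
  unfolding mons_def subset_iff in_keys_iff lessThan_iff mem_Collect_eq by (metis not_le)

lemma mons_add_iff [simp]: "\<mu> + \<nu> \<in> mons n \<longleftrightarrow> \<mu> \<in> mons n \<and> \<nu> \<in> mons n"
  by (auto simp: mons_iff lookup_add)

lemma mons_0 [simp]: "0 \<in> mons n"
  by (simp add: mons_iff)

definition mon :: "nat \<Rightarrow> (nat \<Rightarrow> nat) \<Rightarrow> mono" where
  "mon n f = (\<Sum>l<n. Poly_Mapping.single l (f l))"

lemma lookup_mon: "Poly_Mapping.lookup (mon n f) l = (if l < n then f l else 0)"
  by (simp add: mon_def lookup_sum lookup_single when_def)

lemma mon_in_mons [simp]: "mon n f \<in> mons n"
  by (simp add: mons_iff lookup_mon)

definition dif :: "mono \<times> mono \<Rightarrow> nat \<Rightarrow> int" where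
  "dif p l = int (Poly_Mapping.lookup (fst p) l) - int (Poly_Mapping.lookup (snd p) l)"

definition pos_part :: "nat \<Rightarrow> (nat \<Rightarrow> int) \<Rightarrow> mono" where
  "pos_part n z = mon n (\<lambda>l. nat (z l))"

definition neg_part :: "nat \<Rightarrow> (nat \<Rightarrow> int) \<Rightarrow> mono" where
  "neg_part n z = mon n (\<lambda>l. nat (- z l))"

lemma parts_in_mons [simp]: "pos_part n z \<in> mons n" "neg_part n z \<in> mons n"
  by (simp_all add: pos_part_def neg_part_def)

lemma dif_parts: "l < n \<Longrightarrow> dif (pos_part n z, neg_part n z) l = z l"
  by (simp add: dif_def pos_part_def neg_part_def lookup_mon)

text \<open>Each move contributes one difference up to sign. Coefficients are indexed by vectors and
  not by pairs, since the later counting concerns the set of differences.\<close>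

lemma conn_dif:
  assumes "finite B" "conn B u v"
  shows "\<exists>c::(nat \<Rightarrow> int) \<Rightarrow> int. \<forall>l. dif (u, v) l = (\<Sum>d\<in>dif ` B. c d * d l)"
  using assms(2)
proof (induction rule: conn_induct)
  case refl
  show ?case by (intro exI[of _ "\<lambda>_. 0"]) (simp add: dif_def)
next
  case (step y z)
  then obtain c where c: "\<And>l. dif (u, y) l = (\<Sum>d\<in>dif ` B. c d * d l)" by blast
  obtain a b w where ab: "(a, b) \<in> B \<or> (b, a) \<in> B" "y = a + w" "z = b + w"
    using step.hyps by (auto simp: moves_def)
  obtain s d0 where s: "d0 \<in> dif ` B" "\<And>l. dif (a, b) l = s * d0 l"
  proof (cases "(a, b) \<in> B")
    case True
    then show ?thesis using that[of "dif (a, b)" 1] by auto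
  next
    case False
    then have "(b, a) \<in> B" using ab by auto
    then show ?thesis using that[of "dif (b, a)" "-1"] by (auto simp: dif_def)
  qed
  have "dif (u, z) l = (\<Sum>d\<in>dif ` B. (c d + (if d = d0 then s else 0)) * d l)" for l
  proof -
    have "dif (u, z) l = dif (u, y) l + dif (a, b) l"
      using ab by (simp add: dif_def lookup_add)
    also have "\<dots> = (\<Sum>d\<in>dif ` B. c d * d l) + (\<Sum>d\<in>dif ` B. (if d = d0 then s else 0) * d l)"
      using s assms(1) by (simp add: c if_distrib[of "\<lambda>x. x * _"] cong: if_cong)
    finally show ?thesis by (simp add: sum.distrib distrib_right)
  qed
  then show ?case by (intro exI[of _ "\<lambda>d. c d + (if d = d0 then s else 0)"]) blast
qed

definition mixed :: "(nat \<Rightarrow> int) \<Rightarrow> nat set \<Rightarrow> bool" where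
  "mixed d U \<longleftrightarrow> (\<exists>l\<in>U. d l > 0) \<and> (\<exists>l\<in>U. d l < 0)"

definition dominating :: "nat \<Rightarrow> (nat \<Rightarrow> int) set \<Rightarrow> bool" where
  "dominating n D \<longleftrightarrow> (\<forall>U\<subseteq>{..<n}. U \<noteq> {} \<longrightarrow> card {d\<in>D. mixed d U} < card U)"

definition part_pairs :: "nat \<Rightarrow> (nat \<Rightarrow> int) set \<Rightarrow> (mono \<times> mono) set" where
  "part_pairs n D = (\<lambda>d. (pos_part n d, neg_part n d)) ` D"

text \<open>Suppose each \<open>d\<close> still to be used is blocked at a coordinate
  \<open>p d\<close> where \<open>u\<close> is too small. As \<open>v\<close> is nonnegative there,
  another vector \<open>s d\<close> in use must raise that coordinate, so it has the opposite sign
  at \<open>p d\<close>. Following \<open>s\<close> until it permutes a set \<open>X\<close> gives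
  card \<open>X\<close> vectors, all mixed on the at most card \<open>X\<close> coordinates in the
  image of \<open>p\<close>, against domination.\<close>

lemma dominating_exists_move:
  assumes D: "finite D" "dominating n D" "\<And>d l. d \<in> D \<Longrightarrow> l \<ge> n \<Longrightarrow> d l = 0"
    and c: "\<And>l. int (u l) - int (v l) = (\<Sum>d\<in>D. c d * d l)" and ne: "\<exists>d\<in>D. c d \<noteq> 0"
  shows "\<exists>d\<in>D. c d \<noteq> 0 \<and> (\<forall>l. sgn (c d) * d l \<le> int (u l))"
proof (rule ccontr)
  assume neg: "\<not> ?thesis"
  define T where "T = {d\<in>D. c d \<noteq> 0}"
  have finT: "finite T" and T0: "T \<noteq> {}" using D ne by (auto simp: T_def)
  have "\<exists>l e. int (u l) < sgn (c d) * d l \<and> e \<in> T \<and> sgn (c e) * e l < 0" if d: "d \<in> T" for d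
  proof -
    obtain l where l: "int (u l) < sgn (c d) * d l" using neg d by (force simp: T_def not_le)
    have "\<exists>e\<in>T. sgn (c e) * e l < 0"
    proof (rule ccontr)
      assume "\<not> ?thesis"
      then have nn: "\<And>e. e \<in> T \<Longrightarrow> 0 \<le> sgn (c e) * e l" by (auto simp: not_less)
      have *: "c e * e l = \<bar>c e\<bar> * (sgn (c e) * e l)" for e
        by (simp add: sgn_if)
      have "int (u l) - int (v l) = (\<Sum>e\<in>T. c e * e l)"
        unfolding c T_def using D by (intro sum.mono_neutral_right) auto
      also have "\<dots> = c d * d l + (\<Sum>e\<in>T-{d}. c e * e l)"
        using d finT by (simp add: sum.remove)
      also have "\<dots> \<ge> c d * d l"
        using nn by (auto intro!: sum_nonneg simp: *)
      finally have 1: "c d * d l \<le> int (u l) - int (v l)" .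
      have "1 * (sgn (c d) * d l) \<le> \<bar>c d\<bar> * (sgn (c d) * d l)"
        using d l by (intro mult_right_mono) (auto simp: T_def)
      then have "sgn (c d) * d l \<le> c d * d l" by (simp only: *[of d] mult_1)
      then show False using 1 l by linarith
    qed
    then show ?thesis using l by blast
  qed
  then obtain p s where ps: "\<And>d. d \<in> T \<Longrightarrow> int (u (p d)) < sgn (c d) * d (p d)"
      "\<And>d. d \<in> T \<Longrightarrow> s d \<in> T" "\<And>d. d \<in> T \<Longrightarrow> sgn (c (s d)) * s d (p d) < 0" by metis
  \<comment> \<open>A minimal nonempty set closed under the successor map \<open>s\<close> is permuted by it.\<close>
  let ?Q = "\<lambda>X. X \<subseteq> T \<and> X \<noteq> {} \<and> s ` X \<subseteq> X"
  have "?Q T" using ps T0 by auto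
  then obtain X where X: "?Q X" "\<And>Y. ?Q Y \<Longrightarrow> card X \<le> card Y"
    using ex_has_least_nat[of ?Q T card] by blast
  have finX: "finite X" using X finT finite_subset by blast
  have "?Q (s ` X)" using X(1) by auto
  then have "card X \<le> card (s ` X)" using X(2) by blast
  then have sX: "s ` X = X" using X(1) finX card_seteq[of X "s ` X"] by blast
  let ?U = "p ` X"
  have "d \<in> {d\<in>D. mixed d ?U}" if "d \<in> X" for d
  proof -
    \<comment> \<open>After normalising by the sign of \<open>c d\<close>, the vector is positive at
      its own blocking coordinate and negative at that of its predecessor \<open>e\<close>.\<close>
    have "d \<in> s ` X" by (subst sX) (rule that)
    then obtain e where e: "e \<in> X" "d = s e" by (rule imageE)
    have 1: "sgn (c d) * d (p d) > 0" using ps(1)[of d] that X(1) by auto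
    have 2: "sgn (c d) * d (p e) < 0" using ps(3)[of e] e X(1) by auto
    have "d \<in> D" using that X(1) by (auto simp: T_def)
    moreover have "mixed d ?U"
      using 1 2 that e(1) by (cases "c d > 0") (auto simp: mixed_def sgn_if split: if_splits)
    ultimately show ?thesis by simp
  qed
  then have "card X \<le> card {d\<in>D. mixed d ?U}" using D(1) by (intro card_mono) auto
  moreover have "?U \<subseteq> {..<n}"
  proof
    fix l assume "l \<in> ?U"
    then obtain d where d: "d \<in> X" "l = p d" by auto
    have "d l \<noteq> 0" using ps(1)[of d] d X(1) by auto
    then show "l \<in> {..<n}" using D(3)[of d l] d X(1) by (force simp: T_def)
  qed
  then have "card {d\<in>D. mixed d ?U} < card ?U" using D(2) X(1) by (auto simp: dominating_def)
  moreover have "card ?U \<le> card X" using finX by (rule card_image_le)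
  ultimately show False by linarith
qed

lemma moves_parts:
  assumes d: "d \<in> D \<or> (\<lambda>l. - d l) \<in> D" and le: "\<And>l. d l \<le> int (Poly_Mapping.lookup u l)"
    and n: "\<And>l. l \<ge> n \<Longrightarrow> d l = 0"
  obtains u' where "moves (part_pairs n D) u u'"
    "\<And>l. int (Poly_Mapping.lookup u' l) = int (Poly_Mapping.lookup u l) - d l"
proof -
  define w where "w = u - pos_part n d"
  have u: "u = pos_part n d + w"
  proof (rule poly_mapping_eqI)
    fix l
    show "Poly_Mapping.lookup u l = Poly_Mapping.lookup (pos_part n d + w) l"
      using le[of l] n[of l] by (simp add: w_def lookup_add lookup_minus pos_part_def lookup_mon)
  qed
  have "(pos_part n d, neg_part n d) \<in> part_pairs n D \<or> (neg_part n d, pos_part n d) \<in> part_pairs n D"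
    using d
  proof
    assume "(\<lambda>l. - d l) \<in> D"
    then have "(pos_part n (\<lambda>l. - d l), neg_part n (\<lambda>l. - d l)) \<in> part_pairs n D"
      by (auto simp: part_pairs_def)
    then show ?thesis by (simp add: pos_part_def neg_part_def)
  qed (auto simp: part_pairs_def)
  then have "moves (part_pairs n D) u (neg_part n d + w)" using u by (auto simp: moves_def)
  moreover have "int (Poly_Mapping.lookup (neg_part n d + w) l) = int (Poly_Mapping.lookup u l) - d l" for l
    using n[of l] arg_cong[OF u, of "\<lambda>u. Poly_Mapping.lookup u l"]
    by (simp add: lookup_add pos_part_def neg_part_def lookup_mon)
  ultimately show ?thesis using that by blast
qed

text \<open>The coefficients are paid off one unit at a time: the vector supplied by
  \<open>dominating_exists_move\<close> has its coefficient brought one step nearer to zero,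
  \<open>v\<close> stays fixed, and the sum of absolute values drops.\<close>

lemma dominating_conn:
  assumes D: "finite D" "dominating n D" "\<And>d l. d \<in> D \<Longrightarrow> l \<ge> n \<Longrightarrow> d l = 0"
    and c: "\<And>l. dif (u, v) l = (\<Sum>d\<in>D. c d * d l)"
  shows "conn (part_pairs n D) u v"
  using c
proof (induction "nat (\<Sum>d\<in>D. \<bar>c d\<bar>)" arbitrary: u c rule: less_induct)
  case less
  show ?case
  proof (cases "\<exists>d\<in>D. c d \<noteq> 0")
    case False
    then have "dif (u, v) l = 0" for l using less.prems by simp
    then have "u = v" by (intro poly_mapping_eqI) (simp add: dif_def)
    then show ?thesis by simp
  next
    case True
    have "int (Poly_Mapping.lookup u l) - int (Poly_Mapping.lookup v l) = (\<Sum>d\<in>D. c d * d l)" for l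
      using less.prems[of l] by (simp add: dif_def)
    with dominating_exists_move[of D n "Poly_Mapping.lookup u" "Poly_Mapping.lookup v" c] D True
    obtain d where
      d: "d \<in> D" "c d \<noteq> 0" "\<And>l. sgn (c d) * d l \<le> int (Poly_Mapping.lookup u l)" by blast
    let ?d = "\<lambda>l. sgn (c d) * d l"
    have "?d \<in> D \<or> (\<lambda>l. - ?d l) \<in> D" using d by (auto simp: sgn_if)
    then obtain u' where u': "moves (part_pairs n D) u u'"
        "\<And>l. int (Poly_Mapping.lookup u' l) = int (Poly_Mapping.lookup u l) - ?d l"
      using moves_parts[of ?d D u n] d D(3) by auto
    define c' where "c' = c(d := c d - sgn (c d))"
    have eq: "(\<Sum>e\<in>D. f (c' e) e) = f (c' d) d - f (c d) d + (\<Sum>e\<in>D. f (c e) e)" for f :: "int \<Rightarrow> (nat \<Rightarrow> int) \<Rightarrow> int"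
    proof -
      have "(\<Sum>e\<in>D-{d}. f (c' e) e) = (\<Sum>e\<in>D-{d}. f (c e) e)"
        by (rule sum.cong) (auto simp: c'_def)
      then show ?thesis
        using sum.remove[OF D(1) d(1), of "\<lambda>e. f (c' e) e"] sum.remove[OF D(1) d(1), of "\<lambda>e. f (c e) e"] by simp
    qed
    have "dif (u', v) l = (\<Sum>e\<in>D. c' e * e l)" for l
      using eq[of "\<lambda>a e. a * e l"] less.prems[of l] u'(2)[of l] by (simp add: dif_def c'_def algebra_simps)
    moreover have "nat (\<Sum>e\<in>D. \<bar>c' e\<bar>) < nat (\<Sum>e\<in>D. \<bar>c e\<bar>)"
    proof -
      have "\<bar>c' d\<bar> < \<bar>c d\<bar>" using d by (auto simp: c'_def sgn_if)
      then have "(\<Sum>e\<in>D. \<bar>c' e\<bar>) < (\<Sum>e\<in>D. \<bar>c e\<bar>)" using eq[of "\<lambda>a e. \<bar>a\<bar>"] by simp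
      moreover have "0 \<le> (\<Sum>e\<in>D. \<bar>c' e\<bar>)" by (simp add: sum_nonneg)
      ultimately show ?thesis by linarith
    qed
    ultimately have "conn (part_pairs n D) u' v" using less.hyps by blast
    then show ?thesis using u'(1) moves_conn conn_trans by metis
  qed
qed

subsection \<open>Generators of the lattice congruence\<close>

text \<open>A pair that can be applied to a monomial free of the variables in \<open>U\<close> has
  at most one sign on \<open>U\<close>; by hypothesis its difference then vanishes there, so the
  next monomial is free of them too.\<close>

lemma conn_avoiding:
  assumes B: "\<And>b l. b \<in> B \<Longrightarrow> \<not> mixed (dif b) U \<Longrightarrow> l \<in> U \<Longrightarrow> dif b l = 0"
    and "conn B u v" "\<And>l. l \<in> U \<Longrightarrow> Poly_Mapping.lookup u l = 0"
  shows "conn {b\<in>B. \<not> mixed (dif b) U} u v \<and> (\<forall>l\<in>U. Poly_Mapping.lookup v l = 0)"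
  using assms(2)
proof (induction rule: conn_induct)
  case refl
  then show ?case using assms(3) by simp
next
  case (step y z)
  obtain a b w where ab: "(a, b) \<in> B \<or> (b, a) \<in> B" "y = a + w" "z = b + w"
    using step.hyps by (auto simp: moves_def)
  have y0: "Poly_Mapping.lookup a l = 0 \<and> Poly_Mapping.lookup w l = 0" if "l \<in> U" for l
    using step.IH that ab(2) by (simp add: lookup_add)
  have nm: "\<not> mixed (dif (a, b)) U" "\<not> mixed (dif (b, a)) U"
    using y0 by (auto simp: mixed_def dif_def)
  have "Poly_Mapping.lookup b l = 0" if "l \<in> U" for l
    using ab(1) B[of "(a, b)" l] B[of "(b, a)" l] nm y0[OF that] that by (auto simp: dif_def)
  moreover have "moves {b\<in>B. \<not> mixed (dif b) U} y z"
    using ab nm unfolding moves_def by blast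
  ultimately show ?case
    using step.IH y0 ab(3) by (auto simp: lookup_add intro: conn_trans moves_conn)
qed

section \<open>The relation lattice of a list of vectors\<close>

locale toric =
  fixes m :: nat and A :: "nat list list"
  assumes vecs: "\<forall>v\<in>set A. length v = m \<and> v \<noteq> replicate m 0"
begin

abbreviation "n \<equiv> length A"
abbreviation "E \<equiv> toric_exp A"

definition ker :: "(nat \<Rightarrow> int) \<Rightarrow> bool" where
  "ker z \<longleftrightarrow> (\<forall>l<m. (\<Sum>i<n. z i * int (A!i!l)) = 0)"

text \<open>A form free of the field of the assertion that the binomials of \<open>B\<close>
  generate the toric ideal. The translation in both directions is made by
  \<open>toric_ideal_generated_by_binomials\<close> and
  \<open>gens_of_ideal_generators\<close>.\<close>

definition gens :: "(mono \<times> mono) set \<Rightarrow> bool" where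
  "gens B \<longleftrightarrow> (\<forall>(a, b)\<in>B. a \<in> mons n \<and> b \<in> mons n \<and> E a = E b) \<and>
     (\<forall>u\<in>mons n. \<forall>v\<in>mons n. E u = E v \<longrightarrow> conn B u v)"

lemma length_nth: "i < n \<Longrightarrow> length (A!i) = m"
  using vecs nth_mem by blast

lemma exists_pos_entry:
  assumes "i < n"
  shows "\<exists>l<m. A!i!l > 0"
proof (rule ccontr)
  assume "\<not> ?thesis"
  then have "A!i = replicate m 0"
    using length_nth[OF assms] by (intro nth_equalityI) auto
  then show False using vecs assms nth_mem by blast
qed

lemma lookup_E:
  "Poly_Mapping.lookup (E \<mu>) l = (if l < m then \<Sum>i<n. Poly_Mapping.lookup \<mu> i * (A!i!l) else 0)"
proof -
  have "Poly_Mapping.lookup (E \<mu>) l =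
      (\<Sum>i<n. \<Sum>l'<m. if l' = l then Poly_Mapping.lookup \<mu> i * (A!i!l') else 0)"
    unfolding toric_exp_def
    by (simp add: lookup_sum lookup_single when_def length_nth)
  then show ?thesis by simp
qed

lemma E_add: "E (u + v) = E u + E v"
  by (rule poly_mapping_eqI) (simp add: lookup_E lookup_add sum.distrib distrib_right)

lemma E_zero [simp]: "E 0 = 0"
  by (rule poly_mapping_eqI) (simp add: lookup_E)

lemma E_eq_iff_ker: "E u = E v \<longleftrightarrow> ker (dif (u, v))"
proof -
  have "E u = E v \<longleftrightarrow> (\<forall>l. Poly_Mapping.lookup (E u) l = Poly_Mapping.lookup (E v) l)"
    by (metis poly_mapping_eqI)
  also have "\<dots> \<longleftrightarrow> (\<forall>l<m. int (\<Sum>i<n. Poly_Mapping.lookup u i * (A!i!l)) = int (\<Sum>i<n. Poly_Mapping.lookup v i * (A!i!l)))"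
    by (auto simp: lookup_E simp del: of_nat_sum)
  also have "\<dots> \<longleftrightarrow> ker (dif (u, v))"
    by (simp add: ker_def dif_def left_diff_distrib sum_subtractf)
  finally show ?thesis .
qed

text \<open>Nonnegative coordinates leave no room for cancellation, and \<open>A!t\<close> has a
  positive one. Later sign arguments rest on this pointedness of the semigroup.\<close>

lemma ker_nonpos_zero:
  assumes "ker z" "\<And>t. t < n \<Longrightarrow> z t \<le> 0" "t < n"
  shows "z t = 0"
proof -
  obtain l where l: "l < m" "A!t!l > 0" using exists_pos_entry[OF assms(3)] by blast
  have "(\<Sum>i<n. - z i * int (A!i!l)) = 0"
    using assms(1) l by (simp add: ker_def sum_negf)
  moreover have "\<And>i. i \<in> {..<n} \<Longrightarrow> 0 \<le> - z i * int (A!i!l)"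
    using assms(2) by (auto simp: mult_nonpos_nonneg)
  ultimately have "- z t * int (A!t!l) = 0"
    using assms(3) sum_nonneg_eq_0_iff[of "{..<n}" "\<lambda>i. - z i * int (A!i!l)"] by blast
  then show ?thesis using l by simp
qed

lemma ker_uminus: "ker z \<Longrightarrow> ker (\<lambda>l. - z l)"
  by (simp add: ker_def sum_negf)

lemma ker_opposite_sign:
  assumes "ker z" "t < n" "z t \<noteq> 0"
  shows "\<exists>s<n. z t * z s < 0"
proof (rule ccontr)
  assume neg: "\<not> ?thesis"
  show False
  proof (cases "z t > 0")
    case True
    then have "0 \<le> z s" if "s < n" for s using neg that by (metis mult_pos_neg not_le)
    then show False
      using ker_nonpos_zero[OF ker_uminus[OF assms(1)] _ assms(2)] assms(3) by simp
  next
    case False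
    then have "z t < 0" using assms(3) by simp
    then have "z s \<le> 0" if "s < n" for s using neg that by (metis mult_neg_pos not_le)
    then show False
      using ker_nonpos_zero[OF assms(1) _ assms(2)] assms(3) by simp
  qed
qed

lemma ker_cong: "(\<And>l. l < n \<Longrightarrow> z l = z' l) \<Longrightarrow> ker z \<longleftrightarrow> ker z'"
  by (simp add: ker_def)

lemma E_parts: "ker z \<Longrightarrow> E (pos_part n z) = E (neg_part n z)"
  unfolding E_eq_iff_ker using ker_cong[of "dif (pos_part n z, neg_part n z)" z] dif_parts by blast

lemma ker_sum: "(\<And>d. d \<in> T \<Longrightarrow> ker d) \<Longrightarrow> ker (\<lambda>l. \<Sum>d\<in>T. k d * d l)"
proof -
  assume T: "\<And>d. d \<in> T \<Longrightarrow> ker d"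
  have "(\<Sum>i<n. (\<Sum>d\<in>T. k d * d i) * int (A!i!l)) = 0" if "l < m" for l
  proof -
    have "(\<Sum>i<n. (\<Sum>d\<in>T. k d * d i) * int (A!i!l)) = (\<Sum>d\<in>T. k d * (\<Sum>i<n. d i * int (A!i!l)))"
      unfolding sum_distrib_left sum_distrib_right by (subst sum.swap) (simp add: mult.assoc)
    also have "\<dots> = 0" using T that by (intro sum.neutral) (auto simp: ker_def)
    finally show ?thesis .
  qed
  then show ?thesis by (simp add: ker_def)
qed

lemma gens_dif:
  assumes "gens B" "d \<in> dif ` B"
  shows "ker d" "l \<ge> n \<Longrightarrow> d l = 0"
  using assms E_eq_iff_ker by (auto simp: gens_def dif_def mons_iff)

lemma gens_span:
  assumes "finite B" "gens B" "ker z"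
  shows "\<exists>c::(nat \<Rightarrow> int) \<Rightarrow> int. \<forall>l<n. z l = (\<Sum>d\<in>dif ` B. c d * d l)"
proof -
  have "conn B (pos_part n z) (neg_part n z)"
    using assms E_parts by (simp add: gens_def)
  from conn_dif[OF assms(1) this] show ?thesis using dif_parts by metis
qed

text \<open>Each column outside a maximal independent set depends on that set, and clearing
  denominators gives an integer relation. Restricted to \<open>W\<close>, these relations form a
  diagonal block with nonzero diagonal; in this form the dimension n - rk of the relation space
  enters the later counts.\<close>

lemma kernel_units:
  "\<exists>W\<subseteq>{..<n}. card W = n - lattice_rank m A \<and>
    (\<forall>t\<in>W. \<exists>z. ker z \<and> z t \<noteq> 0 \<and> (\<forall>s\<in>W-{t}. z s = 0))"
proof -
  let ?R = "{card S | S. S \<subseteq> {..<n} \<and> lin_indep_Q m A S}"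
  have fin: "finite ?R"
    by (rule finite_subset[of _ "card ` Pow {..<n}"]) auto
  \<comment> \<open>The empty set makes the set of cardinalities nonempty, so that its
    \<open>Max\<close> is attained.\<close>
  have "card {} \<in> ?R" by (rule CollectI, rule exI[of _ "{}"]) (simp add: lin_indep_Q_def)
  then have "lattice_rank m A \<in> ?R"
    unfolding lattice_rank_def using fin Max_in by blast
  then obtain S where S: "S \<subseteq> {..<n}" "lin_indep_Q m A S" "card S = lattice_rank m A" by auto
  have finS: "finite S" using S finite_subset by blast
  have "\<exists>z. ker z \<and> z t \<noteq> 0 \<and> (\<forall>s\<in>{..<n} - S-{t}. z s = 0)" if t: "t \<in> {..<n} - S" for t
  proof -
    have "\<not> lin_indep_Q m A (insert t S)"
    proof
      assume "lin_indep_Q m A (insert t S)"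
      then have "card (insert t S) \<in> ?R" using t S by blast
      then have "card (insert t S) \<le> lattice_rank m A" unfolding lattice_rank_def using fin Max_ge by blast
      then show False using t finS S by simp
    qed
    then obtain c where c: "\<And>l. l < m \<Longrightarrow> (\<Sum>i\<in>insert t S. c i * of_nat (A!i!l)) = (0::rat)"
      "\<exists>i\<in>insert t S. c i \<noteq> 0" by (auto simp: lin_indep_Q_def)
    have ct: "c t \<noteq> 0"
    proof
      assume "c t = 0"
      then have "\<forall>l<m. (\<Sum>i\<in>S. c i * of_nat (A!i!l)) = (0::rat)"
        using c(1) t finS by simp
      then have "\<forall>i\<in>S. c i = 0" using S(2) by (simp add: lin_indep_Q_def)
      then show False using c(2) \<open>c t = 0\<close> by auto
    qed
    have "finite (insert t S)" using finS by simp
    from common_denominator[OF this, of c] obtain N k where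
      N: "N > 0" "\<And>i. i \<in> insert t S \<Longrightarrow> of_int (k i) = of_int N * c i" by blast
    define z where "z i = (if i \<in> insert t S then k i else 0)" for i
    have "(\<Sum>i<n. z i * int (A!i!l)) = 0" if "l < m" for l
    proof -
      have "of_int (\<Sum>i<n. z i * int (A!i!l)) = (\<Sum>i\<in>insert t S. of_int (k i) * of_nat (A!i!l) :: rat)"
      proof -
        have "(\<Sum>i<n. z i * int (A!i!l)) = (\<Sum>i\<in>insert t S. z i * int (A!i!l))"
          using t S by (intro sum.mono_neutral_right) (auto simp: z_def)
        also have "\<dots> = (\<Sum>i\<in>insert t S. k i * int (A!i!l))"
          by (rule sum.cong) (auto simp: z_def)
        finally show ?thesis by simp
      qed
      also have "\<dots> = (\<Sum>i\<in>insert t S. of_int N * (c i * of_nat (A!i!l)))"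
        by (rule sum.cong) (auto simp: N(2))
      also have "\<dots> = of_int N * (\<Sum>i\<in>insert t S. c i * of_nat (A!i!l))"
        by (simp only: sum_distrib_left)
      finally have "of_int (\<Sum>i<n. z i * int (A!i!l)) = (0::rat)" using c(1) that by simp
      then show ?thesis by linarith
    qed
    then have "ker z" by (simp add: ker_def)
    moreover have "z t \<noteq> 0" using N(1) N(2)[of t] ct by (auto simp: z_def)
    ultimately show ?thesis by (intro exI[of _ z]) (auto simp: z_def)
  qed
  moreover have "card ({..<n} - S) = n - lattice_rank m A"
    using S finS by (simp add: card_Diff_subset)
  ultimately show ?thesis by (intro exI[of _ "{..<n} - S"]) auto
qed

text \<open>A functional supported on \<open>W\<close> that kills all differences of generators
  kills the whole relation lattice, in particular \<open>z\<close>, on which it only sees the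
  coordinate \<open>t\<close>.\<close>

lemma gens_orthogonal_trivial:
  fixes a :: "nat \<Rightarrow> rat"
  assumes "finite B" "gens B" "W \<subseteq> {..<n}" "t \<in> W"
    and unit: "ker z" "z t \<noteq> 0" "\<And>s. s \<in> W-{t} \<Longrightarrow> z s = 0"
    and orth: "\<And>d. d \<in> dif ` B \<Longrightarrow> (\<Sum>s\<in>W. a s * of_int (d s)) = 0"
  shows "a t = 0"
proof -
  obtain c :: "(nat \<Rightarrow> int) \<Rightarrow> int" where c: "\<And>l. l < n \<Longrightarrow> z l = (\<Sum>d\<in>dif ` B. c d * d l)"
    using gens_span[OF assms(1,2) unit(1)] by blast
  have finW: "finite W" using assms(3) finite_subset by blast
  have "(\<Sum>s\<in>W. a s * of_int (z s)) = a t * of_int (z t) + (\<Sum>s\<in>W-{t}. a s * of_int (z s))"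
    using finW assms(4) by (simp add: sum.remove)
  also have "(\<Sum>s\<in>W-{t}. a s * of_int (z s)) = 0" using unit(3) by (intro sum.neutral) auto
  finally have "a t * of_int (z t) = (\<Sum>s\<in>W. a s * of_int (z s))" by simp
  also have "\<dots> = (\<Sum>s\<in>W. a s * (\<Sum>d\<in>dif ` B. of_int (c d) * of_int (d s)))"
    using assms(3) c by (intro sum.cong) auto
  also have "\<dots> = (\<Sum>d\<in>dif ` B. of_int (c d) * (\<Sum>s\<in>W. a s * of_int (d s)))"
    unfolding sum_distrib_left by (subst sum.swap) (simp add: mult_ac)
  also have "\<dots> = 0" using orth by (intro sum.neutral) auto
  finally show ?thesis using unit(2) by simp
qed

lemma gens_card_ge:
  assumes "finite B" "gens B"
  shows "n - lattice_rank m A \<le> card (dif ` B)"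
proof (rule ccontr)
  assume neg: "\<not> ?thesis"
  obtain W where W: "W \<subseteq> {..<n}" "card W = n - lattice_rank m A"
    "\<And>t. t \<in> W \<Longrightarrow> \<exists>z. ker z \<and> z t \<noteq> 0 \<and> (\<forall>s\<in>W-{t}. z s = 0)"
    using kernel_units by auto
  have "finite (dif ` B)" "finite W" "card (dif ` B) < card W"
    using assms W(2) neg finite_subset[OF W(1)] by auto
  from homogeneous_system_nontrivial[OF this, of "\<lambda>s d. of_int (d s) :: rat"]
  obtain a t where a: "t \<in> W" "a t \<noteq> 0" "\<And>d. d \<in> dif ` B \<Longrightarrow> (\<Sum>s\<in>W. a s * of_int (d s) :: rat) = 0"
    by blast
  obtain z where "ker z" "z t \<noteq> 0" "\<And>s. s \<in> W-{t} \<Longrightarrow> z s = 0" using W(3)[OF a(1)] by blast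
  from gens_orthogonal_trivial[OF assms W(1) a(1) this a(3)] a(2) show False by simp
qed

text \<open>In a dependency involving \<open>d0\<close>, any functional that kills the other
  differences kills \<open>d0\<close> as well. Without \<open>d0\<close> there are fewer differences
  than elements of \<open>W\<close>, so a nonzero functional on \<open>W\<close> of this kind
  exists, against \<open>gens_orthogonal_trivial\<close>.\<close>

lemma minimal_gens_independent:
  fixes c :: "(nat \<Rightarrow> int) \<Rightarrow> int"
  assumes "finite B" "gens B" "card B \<le> n - lattice_rank m A"
    and c: "\<And>l. l < n \<Longrightarrow> (\<Sum>d\<in>dif ` B. c d * d l) = 0" and d0: "d0 \<in> dif ` B"
  shows "c d0 = 0"
proof (rule ccontr)
  assume neg: "c d0 \<noteq> 0"
  let ?D = "dif ` B"
  obtain W where W: "W \<subseteq> {..<n}" "card W = n - lattice_rank m A"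
    "\<And>t. t \<in> W \<Longrightarrow> \<exists>z. ker z \<and> z t \<noteq> 0 \<and> (\<forall>s\<in>W-{t}. z s = 0)"
    using kernel_units by auto
  have finD: "finite ?D" and finW: "finite W" using assms(1) finite_subset[OF W(1)] by auto
  have "card (?D - {d0}) < card ?D" using d0 finD by (rule_tac psubset_card_mono) auto
  also have "card ?D \<le> card W" using assms(3) W card_image_le[OF assms(1), of dif] by simp
  finally have "card (?D - {d0}) < card W" .
  from homogeneous_system_nontrivial[OF _ finW this, of "\<lambda>s d. of_int (d s) :: rat"] finD
  obtain a t where a: "t \<in> W" "a t \<noteq> 0" "\<And>d. d \<in> ?D - {d0} \<Longrightarrow> (\<Sum>s\<in>W. a s * of_int (d s) :: rat) = 0"
    by blast
  have "of_int (c d0) * (\<Sum>s\<in>W. a s * of_int (d0 s) :: rat) = (\<Sum>d\<in>?D. of_int (c d) * (\<Sum>s\<in>W. a s * of_int (d s)))"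
  proof -
    have "(\<Sum>d\<in>?D-{d0}. of_int (c d) * (\<Sum>s\<in>W. a s * of_int (d s))) = 0"
      using a(3) by (intro sum.neutral) auto
    then show ?thesis using finD d0 by (simp add: sum.remove)
  qed
  also have "\<dots> = (\<Sum>s\<in>W. a s * of_int (\<Sum>d\<in>?D. c d * d s))"
    unfolding of_int_sum sum_distrib_left by (subst sum.swap) (simp add: mult_ac)
  also have "\<dots> = (\<Sum>s\<in>W. a s * of_int 0)" using c W(1) by (intro sum.cong refl arg_cong[where f = "\<lambda>x. _ * of_int x"]) auto
  finally have "(\<Sum>s\<in>W. a s * of_int (d0 s) :: rat) = 0" using neg by simp
  then have orth: "\<And>d. d \<in> ?D \<Longrightarrow> (\<Sum>s\<in>W. a s * of_int (d s) :: rat) = 0" using a(3) by blast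
  obtain z where "ker z" "z t \<noteq> 0" "\<And>s. s \<in> W-{t} \<Longrightarrow> z s = 0" using W(3)[OF a(1)] by blast
  from gens_orthogonal_trivial[OF assms(1,2) W(1) a(1) this orth] a(2) show False by simp
qed

text \<open>Take a violating \<open>U\<close> of maximal size. Differences that are not mixed on
  \<open>U\<close> vanish on it, so a fiber containing a monomial free of \<open>U\<close> has only
  such monomials. On the other hand the mixed differences are independent on \<open>U\<close> and
  number at least card \<open>U\<close>, hence some relation is constant and positive on
  \<open>U\<close>; its two parts share a fiber, and only one of them is free of
  \<open>U\<close>.\<close>

lemma dominating_of_minimal_gens:
  assumes "finite B" "gens B" "card B \<le> n - lattice_rank m A"
  shows "dominating n (dif ` B)"
proof (rule ccontr)
  let ?D = "dif ` B"
  let ?T = "\<lambda>U. {d\<in>?D. mixed d U}"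
  let ?Q = "\<lambda>U. U \<subseteq> {..<n} \<and> U \<noteq> {} \<and> card U \<le> card (?T U)"
  have finD: "finite ?D" using assms by simp
  assume "\<not> ?thesis"
  then obtain U0 where "?Q U0" by (auto simp: dominating_def not_less)
  moreover have "\<forall>U. ?Q U \<longrightarrow> card U < Suc n"
    using card_mono[OF finite_lessThan, of _ n] by (metis card_lessThan le_imp_less_Suc)
  ultimately have "\<exists>U. ?Q U \<and> (\<forall>V. ?Q V \<longrightarrow> card V \<le> card U)"
    by (rule ex_has_greatest_nat)
  then obtain U where U: "?Q U" "\<And>V. ?Q V \<Longrightarrow> card V \<le> card U" by blast
  define T where "T = ?T U"
  have finU: "finite U" using U finite_subset by blast
  have finT: "finite T" and TD: "T \<subseteq> ?D" using finD by (auto simp: T_def)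
  \<comment> \<open>By maximality of \<open>U\<close>: a vector with only one sign on \<open>U\<close> would become mixed after adding
    one column of the opposite sign.\<close>
  have vanish: "d l = 0" if d: "d \<in> ?D" "\<not> mixed d U" and l: "l \<in> U" for d l
  proof (rule ccontr)
    assume "d l \<noteq> 0"
    moreover have "l < n" using l U(1) by auto
    ultimately obtain s where s: "s < n" "d l * d s < 0"
      using ker_opposite_sign[OF gens_dif(1)[OF assms(2) d(1)]] by blast
    have m: "mixed d (insert s U)" using s(2) l by (auto simp: mixed_def mult_less_0_iff)
    have "s \<notin> U" using s(2) l d(2) by (auto simp: mixed_def mult_less_0_iff)
    have "insert d T \<subseteq> ?T (insert s U)" using m d by (auto simp: T_def mixed_def)
    then have "card (insert d T) \<le> card (?T (insert s U))" using finD by (intro card_mono) auto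
    moreover have "d \<notin> T" using d by (simp add: T_def)
    ultimately have "?Q (insert s U)" using U(1) finT finU \<open>s \<notin> U\<close> s(1) by (auto simp: T_def)
    then have "card (insert s U) \<le> card U" using U(2) by blast
    then show False using \<open>s \<notin> U\<close> finU by simp
  qed
  let ?B0 = "{b\<in>B. \<not> mixed (dif b) U}"
  have avoid: "conn ?B0 u v \<and> (\<forall>l\<in>U. Poly_Mapping.lookup v l = 0)"
    if "u \<in> mons n" "v \<in> mons n" "E u = E v" "\<And>l. l \<in> U \<Longrightarrow> Poly_Mapping.lookup u l = 0" for u v
    using conn_avoiding[of B U u v] vanish assms(2) that by (auto simp: gens_def)
  have integral: "\<exists>N k. N > 0 \<and> (\<forall>d\<in>T. of_int (k d) = of_int N * c d) \<and> ker (\<lambda>l. \<Sum>d\<in>T. k d * d l) \<and>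
      (\<forall>l. of_int (\<Sum>d\<in>T. k d * d l) = of_int N * (\<Sum>d\<in>T. c d * of_int (d l)))" for c :: "(nat \<Rightarrow> int) \<Rightarrow> rat"
  proof -
    obtain N k where N: "N > 0" "\<And>d. d \<in> T \<Longrightarrow> of_int (k d) = of_int N * c d"
      using common_denominator[OF finT, of c] by blast
    have "of_int (\<Sum>d\<in>T. k d * d l) = of_int N * (\<Sum>d\<in>T. c d * of_int (d l))" for l
      using N(2) by (simp add: sum_distrib_left mult.assoc)
    moreover have "ker (\<lambda>l. \<Sum>d\<in>T. k d * d l)"
      using gens_dif(1)[OF assms(2)] TD by (intro ker_sum) auto
    ultimately show ?thesis using N by blast
  qed
  \<comment> \<open>A combination of mixed differences that vanishes on \<open>U\<close> has both
    parts free of \<open>U\<close>, so it is also a combination of the differences that are not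
    mixed. Together this is a dependency among all differences.\<close>
  have indep: "\<forall>d\<in>T. c d = 0" if c: "\<forall>l\<in>U. (\<Sum>d\<in>T. c d * of_int (d l)) = (0::rat)" for c
  proof -
    obtain N k where N: "N > 0" "\<And>d. d \<in> T \<Longrightarrow> of_int (k d) = of_int N * c d"
      "ker (\<lambda>l. \<Sum>d\<in>T. k d * d l)" "\<And>l. of_int (\<Sum>d\<in>T. k d * d l) = of_int N * (\<Sum>d\<in>T. c d * of_int (d l))"
      using integral[of c] by blast
    define z where "z = (\<lambda>l. \<Sum>d\<in>T. k d * d l)"
    have z0: "z l = 0" if "l \<in> U" for l
    proof -
      have "of_int (z l) = (0::rat)" unfolding z_def N(4) using c that by simp
      then show ?thesis by simp
    qed
    have "conn ?B0 (pos_part n z) (neg_part n z)"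
      using avoid[of "pos_part n z" "neg_part n z"] E_parts[OF N(3)] z0
      by (simp add: z_def[symmetric] pos_part_def lookup_mon)
    from conn_dif[OF _ this] assms(1) obtain c' where
      c': "\<And>l. dif (pos_part n z, neg_part n z) l = (\<Sum>d\<in>dif ` ?B0. c' d * d l)" by auto
    have B0: "dif ` ?B0 = ?D - T" by (auto simp: T_def)
    define e where "e d = (if d \<in> T then k d else - c' d)" for d
    have "(\<Sum>d\<in>?D. e d * d l) = 0" if "l < n" for l
    proof -
      have "(\<Sum>d\<in>?D. e d * d l) = (\<Sum>d\<in>T. e d * d l) + (\<Sum>d\<in>?D-T. e d * d l)"
        using sum.subset_diff[OF TD finD, of "\<lambda>d. e d * d l"] by linarith
      also have "(\<Sum>d\<in>T. e d * d l) = z l" by (simp add: z_def e_def)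
      also have "(\<Sum>d\<in>?D-T. e d * d l) = - z l"
        using c'[of l] that by (simp add: B0 dif_parts e_def sum_negf)
      finally show ?thesis by simp
    qed
    then have "\<forall>d\<in>?D. e d = 0" using minimal_gens_independent[OF assms] by blast
    then have "k d = 0" if "d \<in> T" for d using TD that by (metis e_def subsetD)
    then show ?thesis using N(1,2) by fastforce
  qed
  have "card U \<le> card T" using U(1) by (simp add: T_def)
  \<comment> \<open>The constant right-hand side asks for a relation that is positive on all of
    \<open>U\<close>.\<close>
  with independent_square_system_solvable[where T = T and U = U and y = "\<lambda>_. 1"
      and \<phi> = "\<lambda>d l. of_int (d l) :: rat"] finT finU indep
  obtain c where c: "\<And>l. l \<in> U \<Longrightarrow> (\<Sum>d\<in>T. c d * of_int (d l)) = (1::rat)" by blast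
  obtain N k where N: "N > 0" "ker (\<lambda>l. \<Sum>d\<in>T. k d * d l)"
    "\<And>l. of_int (\<Sum>d\<in>T. k d * d l) = of_int N * (\<Sum>d\<in>T. c d * of_int (d l))"
    using integral[of c] by blast
  define z where "z = (\<lambda>l. \<Sum>d\<in>T. k d * d l)"
  have z: "z l = N" if "l \<in> U" for l
  proof -
    have "of_int (z l) = (of_int N :: rat)" unfolding z_def N(3) using c[OF that] by simp
    then show ?thesis by simp
  qed
  have "\<forall>l\<in>U. Poly_Mapping.lookup (pos_part n z) l = 0"
    using avoid[of "neg_part n z" "pos_part n z"] E_parts[OF N(2)] z N(1)
    by (simp add: z_def[symmetric] neg_part_def lookup_mon)
  moreover obtain l where "l \<in> U" "l < n" using U(1) by auto
  ultimately show False using z N(1) by (force simp: pos_part_def lookup_mon)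
qed

end

subsection \<open>Finite generation\<close>

text \<open>Coordinates are treated one after the other. A monotone subsequence of naturals is
  increasing, or decreasing and hence constant from the index of its least value on.\<close>

lemma monotone_subsequence:
  fixes f :: "nat \<Rightarrow> 'i \<Rightarrow> nat"
  assumes "finite I"
  shows "\<exists>g::nat \<Rightarrow> nat. strict_mono g \<and> (\<forall>i\<in>I. mono (\<lambda>k. f (g k) i))"
  using assms
proof (induction I rule: finite_induct)
  case empty
  show ?case by (intro exI[of _ id]) (simp add: strict_mono_def)
next
  case (insert i I)
  then obtain g :: "nat \<Rightarrow> nat" where g: "strict_mono g" "\<And>i. i \<in> I \<Longrightarrow> mono (\<lambda>k. f (g k) i)" by auto
  obtain h :: "nat \<Rightarrow> nat" where h: "strict_mono h" "monoseq (\<lambda>k. f (g (h k)) i)"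
    using seq_monosub[of "\<lambda>k. f (g k) i"] by auto
  have "\<exists>h'::nat \<Rightarrow> nat. strict_mono h' \<and> mono (\<lambda>k. f (g (h' k)) i)"
  proof (cases "mono (\<lambda>k. f (g (h k)) i)")
    case True
    then show ?thesis using h by blast
  next
    case False
    then have dec: "decseq (\<lambda>k. f (g (h k)) i)" using h(2) by (simp add: monoseq_iff)
    obtain N where N: "\<And>k. f (g (h N)) i \<le> f (g (h k)) i"
      using ex_has_least_nat[of "\<lambda>_. True" 0 "\<lambda>k. f (g (h k)) i"] by auto
    have "f (g (h (k + N))) i = f (g (h N)) i" for k
      using N[of "k + N"] decseqD[OF dec, of N "k + N"] by simp
    then have "mono (\<lambda>k. f (g (h (k + N))) i)" by (simp add: mono_def)
    moreover have "strict_mono (\<lambda>k. h (k + N))" using h(1) by (simp add: strict_mono_def)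
    ultimately show ?thesis by (intro exI[of _ "\<lambda>k. h (k + N)"]) simp
  qed
  then obtain h' :: "nat \<Rightarrow> nat" where h': "strict_mono h'" "mono (\<lambda>k. f (g (h' k)) i)" by blast
  have "mono (\<lambda>k. f (g (h' k)) j)" if "j \<in> I" for j
    using g(2)[OF that] strict_mono_mono[OF h'(1)] by (simp add: mono_def)
  moreover have "strict_mono (\<lambda>k. g (h' k))" using g(1) h'(1) by (simp add: strict_mono_def)
  ultimately show ?case using h'(2) by (intro exI[of _ "\<lambda>k. g (h' k)"]) auto
qed

lemma dickson:
  fixes \<phi> :: "'a \<Rightarrow> 'i \<Rightarrow> nat"
  assumes "finite I" "infinite S"
  shows "\<exists>x\<in>S. \<exists>y\<in>S. x \<noteq> y \<and> (\<forall>i\<in>I. \<phi> x i \<le> \<phi> y i)"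
proof -
  obtain s :: "nat \<Rightarrow> 'a" where s: "inj s" "range s \<subseteq> S"
    using infinite_countable_subset[OF assms(2)] by blast
  obtain g :: "nat \<Rightarrow> nat" where g: "strict_mono g" "\<And>i. i \<in> I \<Longrightarrow> mono (\<lambda>k. \<phi> (s (g k)) i)"
    using monotone_subsequence[OF assms(1), of "\<lambda>k. \<phi> (s k)"] by blast
  have "s (g 0) \<noteq> s (g 1)" using s(1) g(1) by (simp add: inj_eq strict_mono_eq)
  moreover have "\<forall>i\<in>I. \<phi> (s (g 0)) i \<le> \<phi> (s (g 1)) i"
    using g(2) monoD[of _ 0 "1::nat"] by blast
  ultimately show ?thesis using s(2) by blast
qed

context toric begin

text \<open>The pairs in a common fiber form a monoid \<open>Z\<close> that is closed under the
  difference of comparable pairs. Its indecomposable elements are therefore pairwise incomparable,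
  hence finite in number by Dickson's lemma, and every pair is a sum of them by induction on the
  total degree \<open>M\<close>.\<close>

lemma finite_gens_exists: "\<exists>B. finite B \<and> gens B"
proof -
  define Z where "Z = {(u, v). u \<in> mons n \<and> v \<in> mons n \<and> E u = E v}"
  define S where "S = {p \<in> Z. \<not> (\<exists>a\<in>Z. \<exists>b\<in>Z. a \<noteq> 0 \<and> b \<noteq> 0 \<and> p = a + b)} - {0}"
  define \<phi> where "\<phi> = (\<lambda>p::mono \<times> mono. \<lambda>x::bool \<times> nat. Poly_Mapping.lookup (if fst x then fst p else snd p) (snd x))"
  have Zdiff: "y - x \<in> Z \<and> y = x + (y - x)" if "x \<in> Z" "y \<in> Z" "\<forall>i\<in>UNIV \<times> {..<n}. \<phi> x i \<le> \<phi> y i" for x y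
  proof -
    obtain a b u v where xy: "x = (a, b)" "y = (u, v)" by (cases x, cases y) auto
    have le: "Poly_Mapping.lookup a l \<le> Poly_Mapping.lookup u l" "Poly_Mapping.lookup b l \<le> Poly_Mapping.lookup v l" for l
      using that(1,3) bspec[OF that(3), of "(True, l)"] bspec[OF that(3), of "(False, l)"]
      by (cases "l < n"; simp add: \<phi>_def xy Z_def mons_iff)+
    have u: "u = a + (u - a)" and v: "v = b + (v - b)"
      using le by (auto intro!: poly_mapping_eqI simp: lookup_add lookup_minus)
    have mem: "u - a \<in> mons n" "v - b \<in> mons n" using that u v xy unfolding Z_def
      by (metis (no_types, lifting) case_prodD mem_Collect_eq mons_add_iff)+
    have "E u = E a + E (u - a)" by (subst u) (rule E_add)
    moreover have "E v = E b + E (v - b)" by (subst v) (rule E_add)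
    moreover have "E u = E v" "E a = E b" using that xy by (auto simp: Z_def)
    ultimately have "E (u - a) = E (v - b)" by simp
    then show ?thesis using mem u v xy by (simp add: Z_def)
  qed
  have "finite S"
  proof (rule ccontr)
    assume "infinite S"
    then obtain x y where xy: "x \<in> S" "y \<in> S" "x \<noteq> y" "\<forall>i\<in>UNIV \<times> {..<n}. \<phi> x i \<le> \<phi> y i"
      using dickson[of "UNIV \<times> {..<n}" S \<phi>] by auto
    have *: "y - x \<in> Z" "y = x + (y - x)" using Zdiff[of x y] xy by (auto simp: S_def)
    have "y - x \<noteq> 0" using *(2) xy(3) by (metis add_0_right)
    then show False using * xy unfolding S_def by blast
  qed
  define M where "M p = (\<Sum>l<n. Poly_Mapping.lookup (fst p) l + Poly_Mapping.lookup (snd p) l)" for p :: "mono \<times> mono"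
  have M_add: "M (p + q) = M p + M q" for p q
    by (simp add: M_def lookup_add sum.distrib)
  have M_pos: "M p > 0" if "p \<in> Z" "p \<noteq> 0" for p
  proof (rule ccontr)
    assume "\<not> M p > 0"
    then have "Poly_Mapping.lookup (fst p) l = 0 \<and> Poly_Mapping.lookup (snd p) l = 0" for l
      using that(1) by (cases "l < n") (auto simp: M_def Z_def mons_iff)
    then have "fst p = 0" "snd p = 0" by (auto intro: poly_mapping_eqI)
    then show False using that(2) by (simp add: prod_eq_iff)
  qed
  have conn: "conn S (fst p) (snd p)" if "p \<in> Z" for p
    using that
  proof (induction "M p" arbitrary: p rule: less_induct)
    case less
    show ?case
    proof (cases "p = 0 \<or> p \<in> S")
      case True
      then show ?thesis using pair_conn[of "fst p" "snd p" S] by auto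
    next
      case False
      then obtain a b where ab: "a \<in> Z" "b \<in> Z" "a \<noteq> 0" "b \<noteq> 0" "p = a + b"
        using less.prems by (auto simp: S_def)
      have "M a < M p" "M b < M p" using M_pos ab by (auto simp: M_add)
      then have c: "conn S (fst a) (snd a)" "conn S (fst b) (snd b)" using less.hyps ab by auto
      have "conn S (fst a + fst b) (snd a + fst b)" using conn_add[OF c(1)] .
      moreover have "conn S (snd a + fst b) (snd a + snd b)"
        using conn_add[OF c(2), of "snd a"] by (simp add: add.commute)
      ultimately show ?thesis using ab conn_trans by (simp add: fst_add snd_add) blast
    qed
  qed
  have "gens S" unfolding gens_def
    using conn by (force simp: S_def Z_def)
  then show ?thesis using \<open>finite S\<close> by blast
qed

end

subsection \<open>Binomial generators of the toric ideal\<close>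

text \<open>The linear functional with prescribed values on monomials. With indicators of fibers it
  describes the toric ideal; with indicators of parts of a fiber it counts generators.\<close>

definition lin :: "(mono \<Rightarrow> 'k::comm_ring_1) \<Rightarrow> 'k mpoly \<Rightarrow> 'k" where
  "lin F p = (\<Sum>\<mu>\<in>Poly_Mapping.keys p. Poly_Mapping.lookup p \<mu> * F \<mu>)"

lemma lin_superset:
  assumes "finite S" "Poly_Mapping.keys p \<subseteq> S"
  shows "lin F p = (\<Sum>\<mu>\<in>S. Poly_Mapping.lookup p \<mu> * F \<mu>)"
  unfolding lin_def using assms by (intro sum.mono_neutral_left) (auto simp: in_keys_iff)

lemma lin_add: "lin F (p + q) = lin F p + lin F q"
proof -
  let ?S = "Poly_Mapping.keys p \<union> Poly_Mapping.keys q"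
  have "lin F (p + q) = (\<Sum>\<mu>\<in>?S. Poly_Mapping.lookup (p + q) \<mu> * F \<mu>)"
    by (rule lin_superset) (auto dest: subsetD[OF keys_add])
  also have "\<dots> = (\<Sum>\<mu>\<in>?S. Poly_Mapping.lookup p \<mu> * F \<mu>) + (\<Sum>\<mu>\<in>?S. Poly_Mapping.lookup q \<mu> * F \<mu>)"
    by (simp add: lookup_add distrib_right sum.distrib)
  also have "\<dots> = lin F p + lin F q" by (simp add: lin_superset[of ?S])
  finally show ?thesis .
qed

lemma lin_zero [simp]: "lin F 0 = 0"
  by (simp add: lin_def)

lemma lin_sum: "lin F (\<Sum>x\<in>X. f x) = (\<Sum>x\<in>X. lin F (f x))"
  by (induction X rule: infinite_finite_induct) (auto simp: lin_add)

lemma lin_single [simp]: "lin F (Poly_Mapping.single \<mu> c) = c * F \<mu>"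
  by (simp add: lin_def)

lemma lin_diff: "lin F (p - q) = lin F p - lin F q"
  using lin_add[of F "p - q" q] by simp

lemma poly_sum_singles: "p = (\<Sum>\<mu>\<in>Poly_Mapping.keys p. Poly_Mapping.single \<mu> (Poly_Mapping.lookup p \<mu>))"
  by (rule poly_mapping_eqI) (simp add: lookup_sum lookup_single when_def in_keys_iff del: sum.delta
      sum.delta' add: sum.delta[OF finite_keys] sum.delta'[OF finite_keys])

lemma lin_mult: "lin F (p * q) = (\<Sum>\<mu>\<in>Poly_Mapping.keys p. Poly_Mapping.lookup p \<mu> * lin (\<lambda>\<nu>. F (\<mu> + \<nu>)) q)"
proof -
  have "p * q = (\<Sum>\<mu>\<in>Poly_Mapping.keys p. \<Sum>\<nu>\<in>Poly_Mapping.keys q.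
      Poly_Mapping.single (\<mu> + \<nu>) (Poly_Mapping.lookup p \<mu> * Poly_Mapping.lookup q \<nu>))"
    by (subst poly_sum_singles[of p], subst poly_sum_singles[of q])
      (simp add: sum_product mult_single)
  then show ?thesis
    by (simp add: lin_sum lin_def[of _ q] sum_distrib_left mult.assoc)
qed

lemma keys_subset_mons: "p \<in> poly_ring n \<longleftrightarrow> Poly_Mapping.keys p \<subseteq> mons n"
  by (auto simp: poly_ring_def mons_def)

lemma poly_ring_add: "p \<in> poly_ring n \<Longrightarrow> q \<in> poly_ring n \<Longrightarrow> p + q \<in> poly_ring n"
  unfolding keys_subset_mons using keys_add[of p q] by blast

lemma poly_ring_diff: "p \<in> poly_ring n \<Longrightarrow> q \<in> poly_ring n \<Longrightarrow> p - q \<in> poly_ring n"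
  unfolding keys_subset_mons using keys_diff[of p q] by blast

lemma poly_ring_mult: "p \<in> poly_ring n \<Longrightarrow> q \<in> poly_ring n \<Longrightarrow> p * q \<in> poly_ring n"
  unfolding keys_subset_mons using keys_mult[of p q] mons_add_iff[of _ _ n] by blast

lemma poly_ring_zero [simp]: "0 \<in> poly_ring n"
  by (simp add: poly_ring_def)

lemma poly_ring_sum: "(\<And>x. x \<in> X \<Longrightarrow> f x \<in> poly_ring n) \<Longrightarrow> (\<Sum>x\<in>X. f x) \<in> poly_ring n"
  by (induction X rule: infinite_finite_induct) (auto intro: poly_ring_add)

lemma poly_ring_single: "\<mu> \<in> mons n \<Longrightarrow> Poly_Mapping.single \<mu> c \<in> poly_ring n"
  by (simp add: keys_subset_mons)

lemma gen_ideal_zero: "0 \<in> gen_ideal n G"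
  unfolding gen_ideal_def by (rule CollectI, rule exI[of _ "\<lambda>_. 0"]) simp

lemma gen_ideal_add: "p \<in> gen_ideal n G \<Longrightarrow> q \<in> gen_ideal n G \<Longrightarrow> p + q \<in> gen_ideal n G"
proof -
  assume "p \<in> gen_ideal n G" "q \<in> gen_ideal n G"
  then obtain c d where "p = (\<Sum>g\<in>G. c g * g)" "q = (\<Sum>g\<in>G. d g * g)"
    "\<forall>g\<in>G. c g \<in> poly_ring n" "\<forall>g\<in>G. d g \<in> poly_ring n" by (auto simp: gen_ideal_def)
  then show ?thesis unfolding gen_ideal_def
    by (intro CollectI exI[of _ "\<lambda>g. c g + d g"]) (auto simp: distrib_right sum.distrib poly_ring_add)
qed

lemma gen_ideal_sum: "(\<And>x. x \<in> X \<Longrightarrow> f x \<in> gen_ideal n G) \<Longrightarrow> (\<Sum>x\<in>X. f x) \<in> gen_ideal n G"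
  by (induction X rule: infinite_finite_induct) (auto intro: gen_ideal_add gen_ideal_zero)

lemma gen_ideal_mult: "r \<in> poly_ring n \<Longrightarrow> p \<in> gen_ideal n G \<Longrightarrow> r * p \<in> gen_ideal n G"
proof -
  assume r: "r \<in> poly_ring n" and "p \<in> gen_ideal n G"
  then obtain c where "p = (\<Sum>g\<in>G. c g * g)" "\<forall>g\<in>G. c g \<in> poly_ring n" by (auto simp: gen_ideal_def)
  then show ?thesis unfolding gen_ideal_def using r
    by (intro CollectI exI[of _ "\<lambda>g. r * c g"]) (auto simp: sum_distrib_left mult.assoc poly_ring_mult)
qed

lemma gen_ideal_generator: "finite G \<Longrightarrow> g \<in> G \<Longrightarrow> g \<in> gen_ideal n G"
  unfolding gen_ideal_def
  by (intro CollectI exI[of _ "\<lambda>h. if h = g then 1 else 0"])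
    (auto simp: if_distrib[of "\<lambda>x. x * _"] poly_ring_single[of 0, where c = 1, simplified] cong: if_cong)

context toric begin

lemma toric_ideal_iff:
  "p \<in> toric_ideal A \<longleftrightarrow> p \<in> poly_ring n \<and> (\<forall>b. lin (\<lambda>\<mu>. if E \<mu> = b then 1 else 0) p = 0)"
proof -
  have "Poly_Mapping.lookup (toric_hom A p) b = lin (\<lambda>\<mu>. if E \<mu> = b then 1 else 0) p" for b
    unfolding toric_hom_def lin_def
    by (simp add: lookup_sum lookup_single when_def if_distrib[of "\<lambda>x. _ * x"] cong: if_cong)
  then show ?thesis by (auto simp: toric_ideal_def intro: poly_mapping_eqI)
qed

text \<open>As \<open>F\<close> is constant on fibers, \<open>lin F\<close> is a combination of
  coefficient sums over fibers, and each such sum vanishes on the ideal.\<close>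

lemma toric_ideal_lin_zero:
  assumes p: "p \<in> toric_ideal A" and F: "\<And>\<mu> \<nu>. \<mu> \<in> mons n \<Longrightarrow> \<nu> \<in> mons n \<Longrightarrow> E \<mu> = E \<nu> \<Longrightarrow> F \<mu> = F \<nu>"
  shows "lin F p = 0"
proof -
  let ?K = "Poly_Mapping.keys p"
  have K: "?K \<subseteq> mons n" using p by (simp add: toric_ideal_iff keys_subset_mons)
  have "lin F p = (\<Sum>b\<in>E ` ?K. \<Sum>\<mu>\<in>{\<mu>\<in>?K. E \<mu> = b}. Poly_Mapping.lookup p \<mu> * F \<mu>)"
    unfolding lin_def by (rule sum.image_gen) simp
  also have "\<dots> = 0"
  proof (rule sum.neutral, rule ballI)
    fix b assume "b \<in> E ` ?K"
    then obtain \<nu> where \<nu>: "\<nu> \<in> ?K" "b = E \<nu>" by auto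
    have "(\<Sum>\<mu>\<in>{\<mu>\<in>?K. E \<mu> = b}. Poly_Mapping.lookup p \<mu> * F \<mu>)
        = (\<Sum>\<mu>\<in>{\<mu>\<in>?K. E \<mu> = b}. Poly_Mapping.lookup p \<mu> * F \<nu>)"
      using \<nu> K by (intro sum.cong refl arg_cong[where f = "(*) _"] F) auto
    also have "\<dots> = (\<Sum>\<mu>\<in>{\<mu>\<in>?K. E \<mu> = b}. Poly_Mapping.lookup p \<mu>) * F \<nu>"
      by (simp add: sum_distrib_right)
    also have "(\<Sum>\<mu>\<in>{\<mu>\<in>?K. E \<mu> = b}. Poly_Mapping.lookup p \<mu>) = lin (\<lambda>\<mu>. if E \<mu> = b then 1 else 0) p"
      unfolding lin_def by (simp add: sum.inter_filter if_distrib[of "\<lambda>x. _ * x"] cong: if_cong)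
    also have "\<dots> = 0" using p by (simp add: toric_ideal_iff)
    finally show "(\<Sum>\<mu>\<in>{\<mu>\<in>?K. E \<mu> = b}. Poly_Mapping.lookup p \<mu> * F \<mu>) = 0" by simp
  qed
  finally show ?thesis .
qed

lemma toric_ideal_mult: "c \<in> poly_ring n \<Longrightarrow> g \<in> toric_ideal A \<Longrightarrow> c * g \<in> toric_ideal A"
proof -
  assume c: "c \<in> poly_ring n" and g: "g \<in> toric_ideal A"
  have "lin (\<lambda>\<nu>. if E (\<mu> + \<nu>) = b then 1 else 0) g = 0" for \<mu> b
    by (rule toric_ideal_lin_zero[OF g]) (simp add: E_add)
  then show ?thesis using c g by (auto simp: toric_ideal_iff poly_ring_mult lin_mult)
qed

lemma toric_ideal_sum: "(\<And>x. x \<in> X \<Longrightarrow> f x \<in> toric_ideal A) \<Longrightarrow> (\<Sum>x\<in>X. f x) \<in> toric_ideal A"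
  by (auto simp: toric_ideal_iff lin_sum intro!: poly_ring_sum)

lemma binomial_in_toric_ideal:
  "u \<in> mons n \<Longrightarrow> v \<in> mons n \<Longrightarrow> E u = E v \<Longrightarrow>
    Poly_Mapping.single u 1 - Poly_Mapping.single v 1 \<in> toric_ideal A"
  by (auto simp: toric_ideal_iff lin_diff intro!: poly_ring_diff poly_ring_single)

text \<open>The binomials along a walk telescope, and each is a monomial multiple of a generator up
  to sign.\<close>

lemma conn_binomial_in_ideal:
  fixes B
  defines "G \<equiv> (\<lambda>(a, b). Poly_Mapping.single a 1 - Poly_Mapping.single b (1::'k::field)) ` B"
  assumes "finite B" "conn B u v" "u \<in> mons n" "gens B"
  shows "Poly_Mapping.single u 1 - Poly_Mapping.single v 1 \<in> gen_ideal n G \<and> v \<in> mons n"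
  using assms(3)
proof (induction rule: conn_induct)
  case refl
  then show ?case using assms(4) gen_ideal_zero by simp
next
  case (step y z)
  obtain a b w where ab: "(a, b) \<in> B \<or> (b, a) \<in> B" "y = a + w" "z = b + w"
    using step.hyps by (auto simp: moves_def)
  have b: "b \<in> mons n" using ab assms(5) by (auto simp: gens_def)
  have w: "w \<in> mons n" using step.IH ab(2) by simp
  have finG: "finite G" using assms(2) by (simp add: G_def)
  have "Poly_Mapping.single a 1 - Poly_Mapping.single b (1::'k) \<in> gen_ideal n G"
  proof (cases "(a, b) \<in> B")
    case True
    then show ?thesis by (intro gen_ideal_generator[OF finG]) (force simp: G_def)
  next
    case False
    then have "Poly_Mapping.single b 1 - Poly_Mapping.single a (1::'k) \<in> gen_ideal n G"
      using ab(1) by (intro gen_ideal_generator[OF finG]) (force simp: G_def)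
    from gen_ideal_mult[OF poly_ring_single[OF mons_0, of "-1"] this]
    show ?thesis by (simp add: right_diff_distrib mult_single single_uminus)
  qed
  from gen_ideal_mult[OF poly_ring_single[OF w, of 1] this]
  have "Poly_Mapping.single y 1 - Poly_Mapping.single z (1::'k) \<in> gen_ideal n G"
    by (simp add: right_diff_distrib mult_single ab add.commute)
  from gen_ideal_add[OF conjunct1[OF step.IH] this] show ?case using b w ab(3) by simp
qed

lemma toric_ideal_generated_by_binomials:
  assumes "finite B" "gens B"
  shows "\<exists>G. finite G \<and> G \<subseteq> poly_ring n \<and> card G \<le> card B \<and> gen_ideal n G = (toric_ideal A :: 'k::field mpoly set)"
proof -
  define G where "G = (\<lambda>(a, b). Poly_Mapping.single a 1 - Poly_Mapping.single b (1::'k)) ` B"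
  have GI: "g \<in> toric_ideal A" if "g \<in> G" for g
    using that assms(2) binomial_in_toric_ideal by (fastforce simp: G_def gens_def)
  have "gen_ideal n G \<subseteq> toric_ideal A"
    using GI by (auto simp: gen_ideal_def intro!: toric_ideal_sum toric_ideal_mult)
  moreover have "p \<in> gen_ideal n G" if p: "p \<in> toric_ideal A" for p
  proof -
    let ?K = "Poly_Mapping.keys p"
    have K: "?K \<subseteq> mons n" using p by (simp add: toric_ideal_iff keys_subset_mons)
    define \<rho> where "\<rho> b = (SOME \<nu>. \<nu> \<in> mons n \<and> E \<nu> = b)" for b
    have \<rho>: "\<rho> (E \<mu>) \<in> mons n \<and> E (\<rho> (E \<mu>)) = E \<mu>" if "\<mu> \<in> mons n" for \<mu>
      unfolding \<rho>_def by (rule someI[of _ \<mu>]) (use that in simp)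
    \<comment> \<open>Moving every monomial of \<open>p\<close> to the representative of its fiber
      adds up the coefficients over each fiber, which gives zero. Subtracting this zero writes
      \<open>p\<close> as a combination of binomials.\<close>
    have zero: "(\<Sum>\<mu>\<in>?K. Poly_Mapping.single (\<rho> (E \<mu>)) (Poly_Mapping.lookup p \<mu>)) = 0"
    proof (rule poly_mapping_eqI)
      fix \<nu>
      have "Poly_Mapping.lookup (\<Sum>\<mu>\<in>?K. Poly_Mapping.single (\<rho> (E \<mu>)) (Poly_Mapping.lookup p \<mu>)) \<nu>
          = lin (\<lambda>\<mu>. if \<rho> (E \<mu>) = \<nu> then 1 else 0) p"
        unfolding lin_def by (simp add: lookup_sum lookup_single when_def if_distrib[of "\<lambda>x. _ * x"] cong: if_cong)
      also have "\<dots> = 0" by (rule toric_ideal_lin_zero[OF p]) simp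
      finally show "Poly_Mapping.lookup (\<Sum>\<mu>\<in>?K. Poly_Mapping.single (\<rho> (E \<mu>)) (Poly_Mapping.lookup p \<mu>)) \<nu>
          = Poly_Mapping.lookup 0 \<nu>" by simp
    qed
    have "p = (\<Sum>\<mu>\<in>?K. Poly_Mapping.single \<mu> (Poly_Mapping.lookup p \<mu>))
        - (\<Sum>\<mu>\<in>?K. Poly_Mapping.single (\<rho> (E \<mu>)) (Poly_Mapping.lookup p \<mu>))"
      unfolding zero using poly_sum_singles[of p] by simp
    also have "\<dots> = (\<Sum>\<mu>\<in>?K. Poly_Mapping.single 0 (Poly_Mapping.lookup p \<mu>) *
        (Poly_Mapping.single \<mu> 1 - Poly_Mapping.single (\<rho> (E \<mu>)) 1))"
      by (simp add: sum_subtractf right_diff_distrib mult_single)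
    also have "\<dots> \<in> gen_ideal n G"
    proof (intro gen_ideal_sum gen_ideal_mult poly_ring_single)
      fix \<mu> assume "\<mu> \<in> ?K"
      then have \<mu>: "\<mu> \<in> mons n" using K by blast
      then have "conn B \<mu> (\<rho> (E \<mu>))" using \<rho>[OF \<mu>] assms(2) by (simp add: gens_def)
      from conn_binomial_in_ideal[OF assms(1) this \<mu> assms(2)]
      show "Poly_Mapping.single \<mu> 1 - Poly_Mapping.single (\<rho> (E \<mu>)) 1 \<in> gen_ideal n G"
        unfolding G_def by blast
    qed simp
    finally show ?thesis .
  qed
  moreover have "G \<subseteq> poly_ring n" using GI by (auto simp: toric_ideal_def)
  moreover have "finite G" "card G \<le> card B" using assms(1) card_image_le by (auto simp: G_def)
  ultimately show ?thesis by blast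
qed

end

text \<open>The identity matrix on \<open>W\<close> factors through a space of dimension card
  \<open>G\<close>.\<close>

lemma unit_vectors_card_le:
  fixes \<phi> :: "'a \<Rightarrow> 'b \<Rightarrow> 'k::field"
  assumes "finite W" "finite G"
    and unit: "\<And>t. t \<in> W \<Longrightarrow> \<exists>a. \<forall>s\<in>W. (\<Sum>g\<in>G. a g * \<phi> g s) = (if s = t then 1 else 0)"
  shows "card W \<le> card G"
proof (rule ccontr)
  assume "\<not> ?thesis"
  then have "card G < card W" by simp
  from homogeneous_system_nontrivial[OF assms(2,1) this, of "\<lambda>s g. \<phi> g s"]
  obtain c t where c: "t \<in> W" "c t \<noteq> 0" "\<And>g. g \<in> G \<Longrightarrow> (\<Sum>s\<in>W. c s * \<phi> g s) = 0" by blast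
  obtain a where a: "\<And>s. s \<in> W \<Longrightarrow> (\<Sum>g\<in>G. a g * \<phi> g s) = (if s = t then 1 else 0)"
    using unit[OF c(1)] by blast
  have "c t = (\<Sum>s\<in>W. c s * (if s = t then 1 else 0))"
    using c(1) assms(1) by (simp add: if_distrib[of "\<lambda>x. _ * x"] cong: if_cong)
  also have "\<dots> = (\<Sum>s\<in>W. c s * (\<Sum>g\<in>G. a g * \<phi> g s))" by (simp add: a)
  also have "\<dots> = (\<Sum>g\<in>G. a g * (\<Sum>s\<in>W. c s * \<phi> g s))"
    unfolding sum_distrib_left by (subst sum.swap) (simp add: mult_ac)
  also have "\<dots> = 0" using c(3) by (simp add: sum.neutral)
  finally show False using c(2) by simp
qed

section \<open>Components of fibers and the number of generators\<close>

context toric begin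

text \<open>The binomial of two monomials with a common variable is that variable times a binomial
  of smaller degree, so it needs no new generator. New generators are needed only to join different
  components of a fiber under this relation.\<close>

definition share :: "mono \<Rightarrow> mono \<Rightarrow> bool" where
  "share u v \<longleftrightarrow> u \<in> mons n \<and> v \<in> mons n \<and> E u = E v \<and>
     (\<exists>l. Poly_Mapping.lookup u l > 0 \<and> Poly_Mapping.lookup v l > 0)"

definition linked :: "mono \<Rightarrow> mono \<Rightarrow> bool" where
  "linked = share\<^sup>*\<^sup>*"

lemma linked_refl [simp]: "linked u u"
  by (simp add: linked_def)

lemma linked_trans: "linked u v \<Longrightarrow> linked v w \<Longrightarrow> linked u w"
  unfolding linked_def by simp

lemma linked_sym: "linked u v \<Longrightarrow> linked v u"
  unfolding linked_def
  by (rule sympD[OF sympI[THEN symp_rtranclp]]) (auto simp: share_def)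

lemma share_linked: "share u v \<Longrightarrow> linked u v"
  unfolding linked_def by simp

lemma linked_fiber: "linked u v \<Longrightarrow> u \<in> mons n \<Longrightarrow> v \<in> mons n \<and> E v = E u"
  unfolding linked_def by (induction rule: rtranclp_induct) (auto simp: share_def)

definition isolated :: "mono \<Rightarrow> bool" where
  "isolated u \<longleftrightarrow> u \<in> mons n \<and> (\<forall>v. share u v \<longrightarrow> v = u)"

lemma isolated_linked:
  assumes "linked u v" "isolated u"
  shows "v = u"
  using assms(1) unfolding linked_def
  by (induction rule: rtranclp_induct) (use assms(2) in \<open>auto simp: isolated_def\<close>)

lemma isolated_zero: "isolated 0"
  by (simp add: isolated_def share_def)

text \<open>Summing coefficients over one component of a fiber is a functional that kills the products of
  the toric ideal with the irrelevant maximal ideal; this replaces the graded Nakayama lemma.\<close>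

lemma lin_linked_mult:
  fixes c :: "'k::field mpoly"
  defines "F \<equiv> \<lambda>t \<mu>. if linked \<mu> t then 1 else (0::'k)"
  assumes c: "c \<in> poly_ring n" and g: "g \<in> toric_ideal A"
  shows "lin (F t) (c * g) = Poly_Mapping.lookup c 0 * lin (F t) g"
proof -
  have "lin (\<lambda>\<nu>. F t (\<mu> + \<nu>)) g = 0" if \<mu>: "\<mu> \<in> Poly_Mapping.keys c" "\<mu> \<noteq> 0" for \<mu>
  proof (rule toric_ideal_lin_zero[OF g])
    fix \<nu> \<nu>' assume \<nu>: "\<nu> \<in> mons n" "\<nu>' \<in> mons n" "E \<nu> = E \<nu>'"
    have \<mu>n: "\<mu> \<in> mons n" using c \<mu>(1) by (auto simp: keys_subset_mons)
    obtain l where "Poly_Mapping.lookup \<mu> l > 0" using \<mu>(2) by (metis gr0I lookup_zero poly_mapping_eqI)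
    then have "share (\<mu> + \<nu>) (\<mu> + \<nu>')"
      using \<nu> \<mu>n by (auto simp: share_def E_add lookup_add)
    then have "linked (\<mu> + \<nu>) (\<mu> + \<nu>')" by (rule share_linked)
    then have "linked (\<mu> + \<nu>) t \<longleftrightarrow> linked (\<mu> + \<nu>') t" using linked_sym linked_trans by blast
    then show "F t (\<mu> + \<nu>) = F t (\<mu> + \<nu>')" by (simp add: F_def)
  qed
  then have "lin (F t) (c * g) = (\<Sum>\<mu>\<in>Poly_Mapping.keys c. if \<mu> = 0 then Poly_Mapping.lookup c 0 * lin (F t) g else 0)"
    unfolding lin_mult by (intro sum.cong) auto
  also have "\<dots> = Poly_Mapping.lookup c 0 * lin (F t) g"
    by (simp add: in_keys_iff)
  finally show ?thesis .
qed

text \<open>Every fiber gets a root component, and each further component is joined to it by one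
  pair. Applying the component functionals to the expansions of these binomials in \<open>G\<close>
  factors an identity matrix through \<open>G\<close>, so there are at most card \<open>G\<close>
  pairs. Within a component the walks exist by induction on the degree.\<close>

lemma gens_of_ideal_generators:
  fixes G :: "'k::field mpoly set"
  assumes G: "finite G" "gen_ideal n G = toric_ideal A"
    and iso: "isolated u0" "isolated v0" "E u0 = E v0"
  shows "\<exists>B. finite B \<and> gens B \<and> card B \<le> card G \<and> (u0 \<noteq> v0 \<longrightarrow> (u0, v0) \<in> B)"
proof -
  define rep where "rep u = (SOME v. linked u v)" for u
  \<comment> \<open>Taking \<open>u0\<close> as the root of its fiber makes \<open>(u0, v0)\<close>
    one of the pairs, since an isolated \<open>v0\<close> is a component by itself.\<close>
  define root where "root b = (if b = E u0 then u0 else rep (SOME v. v \<in> mons n \<and> E v = b))" for b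
  have rep: "linked u (rep u)" for u unfolding rep_def by (rule someI[of _ u]) simp
  have rep_eq: "rep u = rep v" if "linked u v" for u v
  proof -
    have "linked u = linked v" using that linked_sym linked_trans by blast
    then show ?thesis by (simp add: rep_def)
  qed
  have rep_iso: "rep u = u" if "isolated u" for u using isolated_linked[OF rep that] .
  have rep_rep: "rep (rep u) = rep u" for u using rep_eq[OF rep] by metis
  have rep_mons: "rep u \<in> mons n" "E (rep u) = E u" if "u \<in> mons n" for u
    using linked_fiber[OF rep that] by auto
  have root: "root (E u) \<in> mons n \<and> E (root (E u)) = E u" if "u \<in> mons n" for u
  proof (cases "E u = E u0")
    case True
    then show ?thesis using iso(1) by (simp add: root_def isolated_def)
  next
    case False
    have "(SOME v. v \<in> mons n \<and> E v = E u) \<in> mons n \<and> E (SOME v. v \<in> mons n \<and> E v = E u) = E u"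
      by (rule someI[of _ u]) (use that in simp)
    then show ?thesis using False rep_mons by (simp add: root_def)
  qed
  have rep_root: "rep (root b) = root b" for b
    by (simp add: root_def rep_iso[OF iso(1)] rep_rep)
  define R where "R = {r. r \<in> mons n \<and> rep r = r \<and> r \<noteq> root (E r)}"
  have bound: "card W \<le> card G" if W: "W \<subseteq> R" "finite W" for W
  proof (rule unit_vectors_card_le[OF W(2) G(1)])
    let ?F = "\<lambda>t \<mu>. if linked \<mu> t then 1 else (0::'k)"
    fix t assume "t \<in> W"
    then have t: "t \<in> R" using W by blast
    then have tn: "t \<in> mons n" by (simp add: R_def)
    let ?f = "Poly_Mapping.single t 1 - Poly_Mapping.single (root (E t)) (1::'k)"
    have "?f \<in> gen_ideal n G"
      using binomial_in_toric_ideal[OF tn, of "root (E t)"] root[OF tn] G(2) by auto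
    then obtain c where c: "?f = (\<Sum>g\<in>G. c g * g)" "\<And>g. g \<in> G \<Longrightarrow> c g \<in> poly_ring n"
      by (auto simp: gen_ideal_def)
    have GI: "g \<in> toric_ideal A" if "g \<in> G" for g
      using gen_ideal_generator[OF G(1) that, of n] G(2) by simp
    \<comment> \<open>Only the constant terms of the multipliers survive a component functional, so
      they are the entries of the factorization.\<close>
    have "(\<Sum>g\<in>G. Poly_Mapping.lookup (c g) 0 * lin (?F s) g) = (if s = t then 1 else 0)" if "s \<in> W" for s
    proof -
      have s: "s \<in> R" using that W by blast
      have "(\<Sum>g\<in>G. Poly_Mapping.lookup (c g) 0 * lin (?F s) g) = lin (?F s) ?f"
        unfolding c(1) lin_sum using lin_linked_mult[OF c(2) GI] by simp
      also have "\<dots> = ?F s t - ?F s (root (E t))" by (simp add: lin_diff)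
      also have "linked t s \<longleftrightarrow> s = t"
      proof
        assume "linked t s"
        then have "rep t = rep s" by (rule rep_eq)
        then show "s = t" using s t by (simp add: R_def)
      qed simp
      also have "linked (root (E t)) s \<longleftrightarrow> False"
      proof (rule iffI)
        assume as: "linked (root (E t)) s"
        then have "root (E t) = s" using rep_eq[OF as] rep_root s by (simp add: R_def)
        moreover then have "E s = E t" using root[OF tn] by simp
        ultimately show False using s by (simp add: R_def)
      qed simp
      finally show ?thesis by simp
    qed
    then show "\<exists>a. \<forall>s\<in>W. (\<Sum>g\<in>G. a g * lin (?F s) g) = (if s = t then 1 else 0)"
      by (intro exI[of _ "\<lambda>g. Poly_Mapping.lookup (c g) 0"]) blast
  qed
  have finR: "finite R"
  proof (rule ccontr)
    assume "infinite R"
    then obtain W where "W \<subseteq> R" "finite W" "card W = Suc (card G)"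
      using infinite_arbitrarily_large by blast
    then show False using bound[of W] by simp
  qed
  define B where "B = (\<lambda>r. (root (E r), r)) ` R"
  have cardB: "finite B" "card B \<le> card G"
    using finR bound[of R] card_image_le[OF finR, of "\<lambda>r. (root (E r), r)"] by (auto simp: B_def)
  \<comment> \<open>The degree of a fiber is the coordinate sum of its vector. Every variable has
    positive degree, so cancelling a shared variable leads to a fiber of smaller degree.\<close>
  define wt where "wt u = (\<Sum>l<m. Poly_Mapping.lookup (E u) l)" for u
  have "conn B u v" if "u \<in> mons n" "v \<in> mons n" "E u = E v" for u v
    using that
  proof (induction "wt u" arbitrary: u v rule: less_induct)
    case less
    have share: "conn B x y" if xy: "share x y" "E x = E u" for x y
    proof -
      obtain l where l: "Poly_Mapping.lookup x l > 0" "Poly_Mapping.lookup y l > 0"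
        and mem: "x \<in> mons n" "y \<in> mons n" "E x = E y" using xy by (auto simp: share_def)
      let ?e = "Poly_Mapping.single l (1::nat)"
      have eq: "x = (x - ?e) + ?e" "y = (y - ?e) + ?e"
        using l by (auto intro!: poly_mapping_eqI simp: lookup_add lookup_minus lookup_single when_def)
      have ln: "l < n" using l mem(1) by (metis mons_iff not_le less_irrefl)
      have e: "?e \<in> mons n" using ln by (auto simp: mons_iff lookup_single when_def)
      have mem': "x - ?e \<in> mons n" "y - ?e \<in> mons n" using mem eq mons_add_iff by metis+
      have Ee: "E x = E (x - ?e) + E ?e" "E y = E (y - ?e) + E ?e"
        using eq E_add by metis+
      then have Eeq: "E (x - ?e) = E (y - ?e)" using mem(3) by simp
      have "wt ?e > 0"
      proof -
        obtain j where j: "j < m" "A!l!j > 0" using exists_pos_entry[OF ln] by blast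
        have "Poly_Mapping.lookup (E ?e) j = A!l!j"
          using j ln by (simp add: lookup_E lookup_single when_def if_distrib[of "\<lambda>x. x * _"] cong: if_cong)
        then show ?thesis unfolding wt_def using j
          by (intro sum_pos2[of _ j]) auto
      qed
      moreover have "wt u = wt (x - ?e) + wt ?e"
        using xy(2) Ee(1) by (simp add: wt_def lookup_add sum.distrib flip: xy(2))
      ultimately have "conn B (x - ?e) (y - ?e)" using less.hyps[OF _ mem' Eeq] by simp
      then have "conn B ((x - ?e) + ?e) ((y - ?e) + ?e)" by (rule conn_add)
      then show ?thesis using eq by simp
    qed
    have linked: "conn B x y" if "linked x y" "x \<in> mons n" "E x = E u" for x y
      using that(1) unfolding linked_def
    proof (induction rule: rtranclp_induct)
      case (step y z)
      have "E y = E u" using linked_fiber[of x y] step.hyps(1) that by (simp add: linked_def)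
      then show ?case using share[OF step.hyps(2)] step.IH conn_trans by blast
    qed simp
    have to_root: "conn B x (root (E u))" if x: "x \<in> mons n" "E x = E u" for x
    proof -
      have "conn B x (rep x)" using linked[OF rep x] .
      moreover have "conn B (rep x) (root (E u))"
      proof (cases "rep x = root (E u)")
        case False
        then have "rep x \<in> R" using rep_mons[OF x(1)] rep_rep x(2) by (simp add: R_def)
        then have "(root (E (rep x)), rep x) \<in> B" by (auto simp: B_def)
        then show ?thesis using pair_conn conn_sym rep_mons[OF x(1)] x(2) by metis
      qed simp
      ultimately show ?thesis by (rule conn_trans)
    qed
    show ?case using to_root[of u] to_root[of v] less.prems conn_sym conn_trans by metis
  qed
  moreover have "\<forall>(a, b)\<in>B. a \<in> mons n \<and> b \<in> mons n \<and> E a = E b"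
    using root by (auto simp: B_def R_def)
  ultimately have "gens B" by (simp add: gens_def)
  moreover have "(u0, v0) \<in> B" if "u0 \<noteq> v0"
  proof -
    have "root (E v0) = u0" using iso(3) by (simp add: root_def)
    moreover have "v0 \<in> R" using that iso rep_iso calculation by (auto simp: R_def isolated_def)
    ultimately show ?thesis by (auto simp: B_def)
  qed
  ultimately show ?thesis using cardB by blast
qed

text \<open>Finite generation is what makes the \<open>LEAST\<close> in \<open>min_num_gens\<close>
  an attained value.\<close>

lemma toric_CI_D:
  assumes "toric_CI TYPE('k::field) m A"
  shows "\<exists>G::'k mpoly set. finite G \<and> G \<subseteq> poly_ring n \<and> card G = n - lattice_rank m A \<and> gen_ideal n G = toric_ideal A"
proof -
  let ?P = "\<lambda>k. \<exists>G::'k mpoly set. finite G \<and> G \<subseteq> poly_ring n \<and> card G = k \<and> gen_ideal n G = toric_ideal A"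
  obtain B where "finite B" "gens B" using finite_gens_exists by blast
  then obtain G :: "'k mpoly set" where "finite G" "G \<subseteq> poly_ring n" "gen_ideal n G = toric_ideal A"
    using toric_ideal_generated_by_binomials[of B, where ?'k = 'k] by blast
  then have "\<exists>k. ?P k" by (intro exI[of _ "card G"] exI[of _ G]) simp
  then have "?P (LEAST k. ?P k)" by (rule LeastI_ex)
  then show ?thesis using assms unfolding toric_CI_def min_num_gens_def toric_height_def by simp
qed

lemma toric_CI_I:
  assumes "finite B" "gens B" "card B \<le> n - lattice_rank m A"
  shows "toric_CI TYPE('k::field) m A"
proof -
  let ?P = "\<lambda>k. \<exists>G::'k mpoly set. finite G \<and> G \<subseteq> poly_ring n \<and> card G = k \<and> gen_ideal n G = toric_ideal A"
  have lower: "n - lattice_rank m A \<le> k" if k: "?P k" for k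
  proof -
    obtain G :: "'k mpoly set" where G: "finite G \<and> G \<subseteq> poly_ring n \<and> card G = k \<and> gen_ideal n G = toric_ideal A"
      using k by (rule exE)
    \<comment> \<open>The trivial pair \<open>(0, 0)\<close> is isolated and prescribes no
      generator.\<close>
    obtain B' where "finite B'" "gens B'" "card B' \<le> k"
      using gens_of_ideal_generators[of G 0 0] isolated_zero G by auto
    then show ?thesis using gens_card_ge[of B'] card_image_le[of B' dif] by linarith
  qed
  obtain G :: "'k mpoly set" where G: "finite G \<and> G \<subseteq> poly_ring n \<and> card G \<le> card B \<and> gen_ideal n G = toric_ideal A"
    using toric_ideal_generated_by_binomials[OF assms(1,2), where ?'k = 'k] by (rule exE)
  then have "?P (card G)" by (intro exI[of _ G]) simp
  moreover have "card G = n - lattice_rank m A" using lower[OF calculation] G assms(3) by simp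
  ultimately have "?P (n - lattice_rank m A)" by simp
  then have "(LEAST k. ?P k) = n - lattice_rank m A" using lower by (rule Least_equality)
  then show ?thesis unfolding toric_CI_def min_num_gens_def toric_height_def .
qed

end

subsection \<open>Relations from cone membership\<close>

text \<open>View the reals as a rational vector space and expand the solution in a finite
  independent set \<open>H\<close>. By independence the system holds separately for the coefficients
  of each \<open>h\<close>, so every \<open>h\<close> may be replaced by any rational number; one
  close enough to \<open>h\<close> keeps the solution positive.\<close>

lemma rational_positive_solution:
  fixes x :: "'a \<Rightarrow> real" and a :: "'a \<Rightarrow> 'b \<Rightarrow> rat"
  assumes J: "finite J" and pos: "\<And>j. j \<in> J \<Longrightarrow> x j > 0"
    and sol: "\<And>l. l \<in> L \<Longrightarrow> (\<Sum>j\<in>J. x j * of_rat (a j l)) = 0"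
  shows "\<exists>y::'a \<Rightarrow> rat. (\<forall>j\<in>J. y j > 0) \<and> (\<forall>l\<in>L. (\<Sum>j\<in>J. y j * a j l) = 0)"
proof -
  interpret rv: vector_space "\<lambda>(c::rat) (r::real). of_rat c * r"
    by unfold_locales (auto simp: algebra_simps of_rat_add of_rat_mult)
  obtain H where H: "H \<subseteq> x ` J" "rv.independent H" "x ` J \<subseteq> rv.span H"
    using rv.maximal_independent_subset by blast
  have finH: "finite H" using H(1) J finite_subset by blast
  have "\<exists>r. x j = (\<Sum>h\<in>H. of_rat (r h) * h)" if "j \<in> J" for j
    using H(3) that rv.span_finite[OF finH] by (auto simp: image_subset_iff)
  then obtain r where r: "\<And>j. j \<in> J \<Longrightarrow> x j = (\<Sum>h\<in>H. of_rat (r j h) * h)" by metis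
  have coeff: "(\<Sum>j\<in>J. r j h * a j l) = 0" if l: "l \<in> L" and h: "h \<in> H" for l h
  proof -
    have "(\<Sum>h\<in>H. of_rat (\<Sum>j\<in>J. r j h * a j l) * h) = (\<Sum>j\<in>J. (\<Sum>h\<in>H. of_rat (r j h) * h) * of_rat (a j l))"
      unfolding of_rat_sum sum_distrib_right by (subst sum.swap) (simp add: of_rat_mult mult_ac)
    also have "\<dots> = (\<Sum>j\<in>J. x j * of_rat (a j l))" using r by simp
    also have "\<dots> = 0" using sol[OF l] .
    finally have "(\<Sum>h\<in>H. of_rat (\<Sum>j\<in>J. r j h * a j l) * h) = 0" .
    moreover have *: "\<forall>h\<in>H. u h = 0" if "(\<Sum>h\<in>H. of_rat (u h) * h) = 0" for u
      using H(2) that unfolding rv.dependent_finite[OF finH] by blast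
    ultimately show ?thesis using h *[of "\<lambda>h. \<Sum>j\<in>J. r j h * a j l"] by blast
  qed
  define M where "M = 1 + (\<Sum>j\<in>J. \<Sum>h\<in>H. \<bar>of_rat (r j h)\<bar> :: real)"
  have Mj: "(\<Sum>h\<in>H. \<bar>of_rat (r j h)\<bar>) < M" if "j \<in> J" for j
    using member_le_sum[OF that, of "\<lambda>j. \<Sum>h\<in>H. \<bar>of_rat (r j h)\<bar> :: real"] J
    by (simp add: M_def sum_nonneg)
  have M0: "M > 0" unfolding M_def by (intro add_pos_nonneg sum_nonneg) auto
  \<comment> \<open>\<open>M\<close> exceeds the sum of the absolute coefficients of each
    \<open>x j\<close>, so changing every \<open>h\<close> by at most \<open>\<epsilon>\<close>
    changes \<open>x j\<close> by less than its own value.\<close>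
  define \<epsilon> where "\<epsilon> = Min (insert 1 (x ` J)) / M"
  have \<epsilon>: "\<epsilon> > 0" using pos J M0 by (auto simp: \<epsilon>_def)
  have \<epsilon>M: "\<epsilon> * M \<le> x j" if "j \<in> J" for j using J M0 that by (simp add: \<epsilon>_def)
  have "\<exists>q. h < of_rat q \<and> of_rat q < h + \<epsilon>" for h using of_rat_dense[of h "h + \<epsilon>"] \<epsilon> by simp
  then obtain q where q: "\<And>h. h < of_rat (q h)" "\<And>h. of_rat (q h) < h + \<epsilon>" by metis
  define y where "y j = (\<Sum>h\<in>H. r j h * q h)" for j
  have "y j > 0" if j: "j \<in> J" for j
  proof -
    have "x j - of_rat (y j) = (\<Sum>h\<in>H. of_rat (r j h) * (h - of_rat (q h)))"
      using r[OF j] by (simp add: y_def of_rat_sum of_rat_mult sum_subtractf right_diff_distrib)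
    also have "\<dots> \<le> (\<Sum>h\<in>H. \<bar>of_rat (r j h)\<bar> * \<epsilon>)"
    proof (rule sum_mono)
      fix h
      have "\<bar>h - of_rat (q h)\<bar> \<le> \<epsilon>" using q[of h] by linarith
      then have "\<bar>of_rat (r j h)\<bar> * \<bar>h - of_rat (q h)\<bar> \<le> \<bar>of_rat (r j h)\<bar> * \<epsilon>" by (intro mult_left_mono) auto
      then show "of_rat (r j h) * (h - of_rat (q h)) \<le> \<bar>of_rat (r j h)\<bar> * \<epsilon>"
        unfolding abs_mult[symmetric] by linarith
    qed
    also have "\<dots> = (\<Sum>h\<in>H. \<bar>of_rat (r j h)\<bar>) * \<epsilon>" by (simp add: sum_distrib_right)
    also have "\<dots> < M * \<epsilon>" using Mj[OF j] \<epsilon> by (intro mult_strict_right_mono)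
    finally have "x j - of_rat (y j) < M * \<epsilon>" .
    then have "(of_rat (y j) :: real) > 0" using \<epsilon>M[OF j] mult.commute[of M \<epsilon>] by linarith
    then show ?thesis by simp
  qed
  moreover have "(\<Sum>j\<in>J. y j * a j l) = 0" if "l \<in> L" for l
  proof -
    have "(\<Sum>j\<in>J. y j * a j l) = (\<Sum>h\<in>H. q h * (\<Sum>j\<in>J. r j h * a j l))"
      unfolding y_def sum_distrib_left sum_distrib_right by (subst sum.swap) (simp add: mult_ac)
    then show ?thesis using coeff[OF that] by simp
  qed
  ultimately show ?thesis by blast
qed

context toric begin

text \<open>Moving the combination to the other side turns it into a relation with no positive entry
  away from \<open>i\<close>, the form used for all multiples from here on.\<close>

lemma in_semigroup_others_iff:
  assumes i: "i < n"
  shows "in_semigroup_others m A i (map ((*) b) (A!i)) \<longleftrightarrow>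
    (\<exists>z. ker z \<and> z i = int b \<and> (\<forall>t. t \<noteq> i \<longrightarrow> z t \<le> 0))"
proof
  assume "in_semigroup_others m A i (map ((*) b) (A!i))"
  then obtain c :: "nat \<Rightarrow> nat" where c: "\<And>l. l < m \<Longrightarrow> b * (A!i!l) = (\<Sum>j\<in>{..<n} - {i}. c j * (A!j!l))"
    using length_nth[OF i] by (auto simp: in_semigroup_others_def)
  define z where "z t = (if t = i then int b else - int (c t))" for t
  have "(\<Sum>t<n. z t * int (A!t!l)) = 0" if "l < m" for l
  proof -
    have "(\<Sum>t<n. z t * int (A!t!l)) = int b * int (A!i!l) + (\<Sum>t\<in>{..<n}-{i}. z t * int (A!t!l))"
      using i by (subst sum.remove[of _ i]) (auto simp: z_def)
    also have "(\<Sum>t\<in>{..<n}-{i}. z t * int (A!t!l)) = - int (\<Sum>t\<in>{..<n}-{i}. c t * (A!t!l))"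
      by (simp add: z_def sum_negf)
    finally show ?thesis by (simp flip: c[OF that])
  qed
  then have "ker z" by (simp add: ker_def)
  then show "\<exists>z. ker z \<and> z i = int b \<and> (\<forall>t. t \<noteq> i \<longrightarrow> z t \<le> 0)"
    by (intro exI[of _ z]) (simp add: z_def)
next
  assume "\<exists>z. ker z \<and> z i = int b \<and> (\<forall>t. t \<noteq> i \<longrightarrow> z t \<le> 0)"
  then obtain z where z: "ker z" "z i = int b" "\<And>t. t \<noteq> i \<Longrightarrow> z t \<le> 0" by blast
  have "b * (A!i!l) = (\<Sum>j\<in>{..<n} - {i}. nat (- z j) * (A!j!l))" if "l < m" for l
  proof -
    have "0 = (\<Sum>t<n. z t * int (A!t!l))" using z(1) that by (simp add: ker_def)
    also have "\<dots> = int b * int (A!i!l) + (\<Sum>t\<in>{..<n}-{i}. z t * int (A!t!l))"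
      using i z(2) by (subst sum.remove[of _ i]) auto
    also have "(\<Sum>t\<in>{..<n}-{i}. z t * int (A!t!l)) = - int (\<Sum>t\<in>{..<n}-{i}. nat (- z t) * (A!t!l))"
      using z(3) by (simp add: sum_negf[symmetric] del: sum_negf)
    finally have "int (b * (A!i!l)) = int (\<Sum>t\<in>{..<n}-{i}. nat (- z t) * (A!t!l))" by simp
    then show ?thesis by (simp only: of_nat_eq_iff)
  qed
  then show "in_semigroup_others m A i (map ((*) b) (A!i))"
    using length_nth[OF i] unfolding in_semigroup_others_def by (intro exI[of _ "\<lambda>j. nat (- z j)"]) auto
qed

lemma mult_m_eq:
  "i < n \<Longrightarrow> mult_m m A i = (LEAST b. b > 0 \<and> (\<exists>z. ker z \<and> z i = int b \<and> (\<forall>t. t \<noteq> i \<longrightarrow> z t \<le> 0)))"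
  unfolding mult_m_def by (simp add: in_semigroup_others_iff)

text \<open>Cone membership has real coefficients, while \<open>mult_m\<close> needs an integral
  relation; this makes the set behind its \<open>LEAST\<close> nonempty.\<close>

lemma in_cone_relation:
  assumes i: "i < n" and cone: "in_cone m A i"
  shows "\<exists>b>0. \<exists>z. ker z \<and> z i = int b \<and> (\<forall>t. t \<noteq> i \<longrightarrow> z t \<le> 0)"
proof -
  obtain c :: "nat \<Rightarrow> real" where c: "\<And>j. c j \<ge> 0"
    "\<And>l. l < m \<Longrightarrow> real (A!i!l) = (\<Sum>j\<in>{..<n} - {i}. c j * real (A!j!l))"
    using cone by (auto simp: in_cone_def)
  \<comment> \<open>Restricting to the support gives the strict positivity that
    \<open>rational_positive_solution\<close> asks for.\<close>
  define S where "S = {j \<in> {..<n} - {i}. c j > 0}"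
  have finS: "finite S" "i \<notin> S" by (auto simp: S_def)
  define x where "x = c(i := 1)"
  define a where "a j l = (if j = i then - rat_of_nat (A!j!l) else rat_of_nat (A!j!l))" for j l
  have sol: "(\<Sum>j\<in>insert i S. x j * of_rat (a j l)) = 0" if "l \<in> {..<m}" for l
  proof -
    have "(\<Sum>j\<in>insert i S. x j * of_rat (a j l)) = - real (A!i!l) + (\<Sum>j\<in>S. x j * of_rat (a j l))"
      using finS by (simp add: x_def a_def of_rat_minus)
    also have "(\<Sum>j\<in>S. x j * of_rat (a j l)) = (\<Sum>j\<in>S. c j * real (A!j!l))"
      using finS by (intro sum.cong) (auto simp: x_def a_def)
    also have "\<dots> = (\<Sum>j\<in>{..<n} - {i}. c j * real (A!j!l))"
    proof (intro sum.mono_neutral_left ballI)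
      fix t assume "t \<in> {..<n} - {i} - S"
      then have "\<not> c t > 0" by (auto simp: S_def)
      then have "c t = 0" using c(1)[of t] by linarith
      then show "c t * real (A!t!l) = 0" by simp
    qed (auto simp: S_def)
    finally show ?thesis using c(2) that by simp
  qed
  have fin: "finite (insert i S)" using finS by simp
  have xpos: "\<And>j. j \<in> insert i S \<Longrightarrow> x j > 0" by (auto simp: x_def S_def)
  obtain y where
    y: "\<forall>j\<in>insert i S. y j > 0" "\<forall>l\<in>{..<m}. (\<Sum>j\<in>insert i S. y j * a j l) = 0"
    using rational_positive_solution[of "insert i S" x "{..<m}" a, OF fin xpos sol] by blast
  obtain N k where N: "N > 0" "\<And>j. j \<in> insert i S \<Longrightarrow> of_int (k j) = of_int N * y j"
    using common_denominator[OF fin, of y] by blast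
  have kpos: "k j > 0" if "j \<in> insert i S" for j
  proof -
    have "of_int (k j) > (0::rat)" unfolding N(2)[OF that] using N(1) bspec[OF y(1) that] by simp
    then show ?thesis by simp
  qed
  define z where "z t = (if t = i then k i else if t \<in> S then - k t else 0)" for t
  have "(\<Sum>t<n. z t * int (A!t!l)) = 0" if "l < m" for l
  proof -
    have "(\<Sum>t<n. z t * int (A!t!l)) = (\<Sum>t\<in>insert i S. z t * int (A!t!l))"
      using i by (intro sum.mono_neutral_right) (auto simp: z_def S_def)
    then have "of_int (\<Sum>t<n. z t * int (A!t!l)) = (\<Sum>t\<in>insert i S. of_int (z t * int (A!t!l)) :: rat)" by simp
    also have "\<dots> = (\<Sum>t\<in>insert i S. - of_int N * (y t * a t l))"
      using finS by (intro sum.cong refl) (auto simp: z_def a_def N(2))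
    also have "\<dots> = - of_int N * (\<Sum>t\<in>insert i S. y t * a t l)" by (simp only: sum_distrib_left)
    also have "\<dots> = 0" using y(2) that by simp
    finally show ?thesis by linarith
  qed
  then have "ker z" by (simp add: ker_def)
  moreover have "z i = int (nat (k i))" "nat (k i) > 0" using kpos[of i] by (auto simp: z_def)
  moreover have "\<forall>t. t \<noteq> i \<longrightarrow> z t \<le> 0" using kpos by (force simp: z_def less_imp_le)
  ultimately show ?thesis by blast
qed

text \<open>A monomial sharing \<open>x_i\<close> with the pure power lets a power of
  \<open>x_i\<close> be cancelled. If some power is left on the pure side, it gives a smaller
  positive multiple; otherwise the difference has no positive entry and is zero.\<close>

lemma isolated_single:
  assumes i: "i < n" and min: "\<And>c z. 0 < c \<Longrightarrow> c < b \<Longrightarrow> ker z \<Longrightarrow> z i = int c \<Longrightarrow> \<exists>t. t \<noteq> i \<and> z t > 0"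
  shows "isolated (Poly_Mapping.single i b)"
  unfolding isolated_def
proof (intro conjI allI impI)
  let ?u = "Poly_Mapping.single i b"
  show "?u \<in> mons n" using i by (auto simp: mons_iff lookup_single when_def)
  fix v assume sh: "share ?u v"
  then have v: "v \<in> mons n" and kr: "ker (dif (?u, v))" and vi: "Poly_Mapping.lookup v i > 0"
    by (auto simp: share_def E_eq_iff_ker lookup_single when_def split: if_splits)
  have le: "dif (?u, v) t \<le> 0" if "t \<noteq> i" for t using that by (simp add: dif_def lookup_single when_def)
  have "\<not> Poly_Mapping.lookup v i < b"
  proof
    assume lt: "Poly_Mapping.lookup v i < b"
    have "dif (?u, v) i = int (b - Poly_Mapping.lookup v i)" using lt by (simp add: dif_def)
    from min[OF _ _ kr this] lt vi le show False by force
  qed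
  then have "dif (?u, v) i \<le> 0" by (simp add: dif_def)
  then have "dif (?u, v) t \<le> 0" for t using le by (cases "t = i") auto
  then have "dif (?u, v) t = 0" if "t < n" for t using ker_nonpos_zero[OF kr _ that] by blast
  then show "v = ?u"
    using v i by (intro poly_mapping_eqI) (metis (no_types, lifting) dif_def eq_iff_diff_eq_0 fst_conv
        lookup_single_not_eq mons_iff not_le of_nat_eq_iff snd_conv)
qed

end

subsection \<open>Merging two proportional vectors\<close>

lemma lin_indep_Q_rescale:
  assumes indep: "lin_indep_Q m A S" and inj: "inj_on f S"
    and \<alpha>: "\<And>s. s \<in> S \<Longrightarrow> \<alpha> s \<noteq> 0"
    and eq: "\<And>s l. s \<in> S \<Longrightarrow> l < m \<Longrightarrow> of_nat (A!s!l) = \<alpha> s * (of_nat (A'!(f s)!l) :: rat)"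
  shows "lin_indep_Q m A' (f ` S)"
  unfolding lin_indep_Q_def
proof (intro allI impI)
  fix c :: "nat \<Rightarrow> rat"
  assume c: "\<forall>l<m. (\<Sum>i\<in>f ` S. c i * of_nat (A'!i!l)) = 0"
  have "(\<Sum>s\<in>S. (c (f s) / \<alpha> s) * of_nat (A!s!l)) = 0" if "l < m" for l
  proof -
    have "(\<Sum>s\<in>S. (c (f s) / \<alpha> s) * of_nat (A!s!l)) = (\<Sum>s\<in>S. c (f s) * of_nat (A'!(f s)!l))"
      using \<alpha> eq that by (intro sum.cong) auto
    also have "\<dots> = 0" using c that by (simp add: sum.reindex[OF inj])
    finally show ?thesis .
  qed
  then have "\<forall>s\<in>S. c (f s) / \<alpha> s = 0"
    using indep[unfolded lin_indep_Q_def, rule_format, of "\<lambda>s. c (f s) / \<alpha> s"] by blast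
  then show "\<forall>i\<in>f ` S. c i = 0" using \<alpha> by auto
qed

lemma mixed_uminus: "mixed (\<lambda>l. - d l) U \<longleftrightarrow> mixed d U"
  by (auto simp: mixed_def)

text \<open>Here \<open>p = m\<^sub>j\<close> and \<open>q = m\<^sub>i\<close>, so that \<open>a\<^sub>i = p g\<close> and \<open>a\<^sub>j = q g\<close> for \<open>g = gcd {a\<^sub>i, a\<^sub>j}\<close>.\<close>

locale merging = toric +
  fixes i j p q :: nat
  assumes ij: "i < j" "j < length A"
    and coprime_pq: "coprime p q" and pq_pos: "p > 0" "q > 0"
    and proportional: "\<And>l. l < m \<Longrightarrow> q * (A!i!l) = p * (A!j!l)"
begin

abbreviation "A' \<equiv> merge_list A i j"

lemma length_merge [simp]: "length A' = n - 1"
  by (simp add: merge_list_def)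

definition skip :: "nat \<Rightarrow> nat" where
  "skip r = (if r < j then r else Suc r)"

lemma inj_skip: "inj skip"
  by (auto simp: inj_def skip_def split: if_splits)

lemma skip_neq_j [simp]: "skip r \<noteq> j"
  by (simp add: skip_def)

lemma skip_i [simp]: "skip r = i \<longleftrightarrow> r = i"
  using ij by (auto simp: skip_def)

lemma skip_less: "r < n - 1 \<Longrightarrow> skip r < n"
  using ij by (auto simp: skip_def)

lemma skip_surj: "t \<noteq> j \<Longrightarrow> \<exists>r. skip r = t \<and> (t < n \<longrightarrow> r < n - 1)"
  using ij by (intro exI[of _ "if t < j then t else t - 1"]) (auto simp: skip_def)

lemma skip_image: "skip ` {..<n - 1} = {..<n} - {j}"
proof (intro equalityI subsetI)
  fix t assume "t \<in> {..<n} - {j}"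
  then obtain r where "skip r = t" "r < n - 1" using skip_surj[of t] by blast
  then show "t \<in> skip ` {..<n - 1}" by blast
qed (use skip_less in auto)

lemma gcd_factor:
  assumes "l < m"
  shows "A!i!l = p * gcd (A!i!l) (A!j!l)" "A!j!l = q * gcd (A!i!l) (A!j!l)"
proof -
  have "p dvd q * (A!i!l)" using proportional[OF assms] by simp
  then obtain k where k: "A!i!l = p * k" using coprime_pq by (auto simp: coprime_dvd_mult_right_iff elim: dvdE)
  then have k': "A!j!l = q * k" using proportional[OF assms] pq_pos by simp
  have "gcd (A!i!l) (A!j!l) = k" unfolding k k' using coprime_pq by (simp add: gcd_mult_distrib_nat[symmetric] mult.commute)
  then show "A!i!l = p * gcd (A!i!l) (A!j!l)" "A!j!l = q * gcd (A!i!l) (A!j!l)" using k k' by auto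
qed

lemma nth_merge: "r < n - 1 \<Longrightarrow> A'!r = (if r = i then gcd_vec (A!i) (A!j) else A!(skip r))"
  by (simp add: merge_list_def skip_def)

lemma nth_merge_entry:
  assumes "r < n - 1" "l < m"
  shows "A'!r!l = (if r = i then gcd (A!i!l) (A!j!l) else A!(skip r)!l)"
  using assms length_nth[of i] length_nth[of j] ij by (simp add: nth_merge gcd_vec_def)

sublocale M: toric m A'
proof
  show "\<forall>v\<in>set A'. length v = m \<and> v \<noteq> replicate m 0"
  proof
    fix v assume "v \<in> set A'"
    then obtain r where r: "r < n - 1" "v = A'!r" by (auto simp: in_set_conv_nth)
    have "length v = m"
      using r length_nth[of i] length_nth[of j] length_nth[OF skip_less[OF r(1)]] ij
      by (simp add: nth_merge gcd_vec_def)
    moreover obtain l where l: "l < m" "A!(skip r)!l > 0" using exists_pos_entry[OF skip_less[OF r(1)]] by blast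
    have "v!l > 0" using l r nth_merge_entry[OF r(1) l(1)] ij by (auto simp: skip_def)
    then have "v \<noteq> replicate m 0" using l(1) by auto
    ultimately show "length v = m \<and> v \<noteq> replicate m 0" by blast
  qed
qed

definition merge :: "(nat \<Rightarrow> int) \<Rightarrow> nat \<Rightarrow> int" where
  "merge z r = (if r = i then int p * z i + int q * z j else z (skip r))"

text \<open>With a_i = p g and a_j = q g the two columns contribute (p z_i + q z_j) g, which is the
  contribution of the merged entry.\<close>

lemma ker_merge: "M.ker (merge z) \<longleftrightarrow> ker z"
proof -
  have "(\<Sum>r<n - 1. merge z r * int (A'!r!l)) = (\<Sum>s<n. z s * int (A!s!l))" if l: "l < m" for l
  proof -
    let ?g = "gcd (A!i!l) (A!j!l)"
    let ?f = "\<lambda>s. if s = i then (int p * z i + int q * z j) * int ?g else z s * int (A!s!l)"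
    have "(\<Sum>r<n - 1. merge z r * int (A'!r!l)) = (\<Sum>r<n - 1. ?f (skip r))"
      using l by (intro sum.cong) (auto simp: merge_def nth_merge_entry)
    also have "\<dots> = (\<Sum>s\<in>{..<n} - {j}. ?f s)"
      using sum.reindex[OF inj_on_subset[OF inj_skip], of "{..<n - 1}" ?f]
      unfolding skip_image comp_def by simp
    also have "\<dots> = ?f i + (\<Sum>s\<in>{..<n} - {j} - {i}. ?f s)"
      using ij by (subst sum.remove[of _ i]) auto
    also have "(\<Sum>s\<in>{..<n} - {j} - {i}. ?f s) = (\<Sum>s\<in>{..<n} - {j} - {i}. z s * int (A!s!l))"
      by (rule sum.cong) auto
    also have "?f i = z i * int (A!i!l) + z j * int (A!j!l)"
    proof -
      have "int (A!i!l) = int p * int ?g" "int (A!j!l) = int q * int ?g"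
        using gcd_factor[OF l] by (metis of_nat_mult)+
      then show ?thesis by (simp add: algebra_simps)
    qed
    also have "z i * int (A!i!l) + z j * int (A!j!l) + (\<Sum>s\<in>{..<n} - {j} - {i}. z s * int (A!s!l))
        = (\<Sum>s<n. z s * int (A!s!l))"
      using ij by (simp add: sum.remove[of "{..<n}" j] sum.remove[of "{..<n} - {j}" i])
    finally show ?thesis .
  qed
  then show ?thesis unfolding M.ker_def ker_def by simp
qed

text \<open>The vectors a_i, a_j and g are proportional, so an independent set contains at most one
  of \<open>i\<close>, \<open>j\<close>, and sending either to \<open>i\<close> matches the
  independent sets of both lists. As the length drops by one, so does the height.\<close>

lemma lattice_rank_merge: "lattice_rank m A' = lattice_rank m A"
proof -
  have "{card S | S. S \<subseteq> {..<n - 1} \<and> lin_indep_Q m A' S} = {card S | S. S \<subseteq> {..<n} \<and> lin_indep_Q m A S}"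
    (is "?L = ?R")
  proof (intro equalityI subsetI)
    fix x assume "x \<in> ?L"
    then obtain S where S: "x = card S" "S \<subseteq> {..<n - 1}" "lin_indep_Q m A' S" by blast
    have "lin_indep_Q m A (skip ` S)"
    proof (rule lin_indep_Q_rescale[OF S(3) inj_on_subset[OF inj_skip subset_UNIV], of "\<lambda>s. if s = i then 1 / of_nat p else 1"])
      fix s l assume sl: "s \<in> S" "l < m"
      have "rat_of_nat (A!i!l) = of_nat p * of_nat (gcd (A!i!l) (A!j!l))"
        using gcd_factor[OF sl(2)] by (metis of_nat_mult)
      then show "rat_of_nat (A'!s!l) = (if s = i then 1 / of_nat p else 1) * of_nat (A!(skip s)!l)"
        using sl S(2) pq_pos ij by (auto simp: nth_merge_entry subset_iff skip_def)
    qed (use pq_pos in auto)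
    moreover have "skip ` S \<subseteq> {..<n}" using S(2) skip_less by auto
    moreover have "card (skip ` S) = x" using S(1) by (simp add: card_image inj_on_subset[OF inj_skip])
    ultimately show "x \<in> ?R" by blast
  next
    fix x assume "x \<in> ?R"
    then obtain S where S: "x = card S" "S \<subseteq> {..<n}" "lin_indep_Q m A S" by blast
    have finS: "finite S" using S(2) finite_subset by blast
    have nij: "\<not> (i \<in> S \<and> j \<in> S)"
    proof
      assume both: "i \<in> S \<and> j \<in> S"
      let ?c = "\<lambda>s. if s = i then of_nat q else if s = j then - of_nat p else (0::rat)"
      have "(\<Sum>s\<in>S. ?c s * of_nat (A!s!l)) = 0" if "l < m" for l
      proof -
        have "(\<Sum>s\<in>S. ?c s * of_nat (A!s!l)) = (\<Sum>s\<in>{i, j}. ?c s * of_nat (A!s!l))"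
          using both finS by (intro sum.mono_neutral_right) auto
        also have "\<dots> = rat_of_nat (q * (A!i!l)) - rat_of_nat (p * (A!j!l))" using ij by simp
        finally show ?thesis using proportional[OF that] by simp
      qed
      then have "\<forall>s\<in>S. ?c s = 0"
        using S(3)[unfolded lin_indep_Q_def, rule_format, of ?c] by blast
      then show False using both pq_pos by auto
    qed
    define f where "f s = (if s < j then s else if s = j then i else s - 1)" for s
    define \<alpha> where "\<alpha> s = (if s = i then rat_of_nat p else if s = j then of_nat q else 1)" for s
    have inj: "inj_on f S" using nij ij by (auto simp: inj_on_def f_def split: if_splits)
    have "lin_indep_Q m A' (f ` S)"
    proof (rule lin_indep_Q_rescale[OF S(3) inj, of \<alpha>])
      fix s l assume sl: "s \<in> S" "l < m"
      have "rat_of_nat (A!i!l) = of_nat p * of_nat (gcd (A!i!l) (A!j!l))"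
        "rat_of_nat (A!j!l) = of_nat q * of_nat (gcd (A!i!l) (A!j!l))"
        using gcd_factor[OF sl(2)] by (metis of_nat_mult)+
      moreover have "f s < n - 1" using sl S(2) ij by (auto simp: f_def subset_iff)
      moreover have "s \<noteq> i \<Longrightarrow> s \<noteq> j \<Longrightarrow> f s \<noteq> i \<and> skip (f s) = s" using ij by (auto simp: f_def skip_def)
      moreover have "f i = i" "f j = i" using ij by (auto simp: f_def)
      ultimately show "rat_of_nat (A!s!l) = \<alpha> s * of_nat (A'!(f s)!l)"
        using sl by (auto simp: nth_merge_entry \<alpha>_def)
    qed (use pq_pos in \<open>auto simp: \<alpha>_def\<close>)
    moreover have "f ` S \<subseteq> {..<n - 1}" using S(2) ij by (auto simp: f_def)
    moreover have "card (f ` S) = x" using S(1) inj by (simp add: card_image)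
    ultimately show "x \<in> ?L" by blast
  qed
  then show ?thesis by (simp add: lattice_rank_def)
qed

text \<open>Since \<open>p\<close> and \<open>q\<close> are positive, a sign of p z_i + q z_j must
  already occur at z_i or z_j.\<close>

lemma mixed_merge:
  assumes "mixed (merge d) U"
  shows "mixed d (if i \<in> U then insert j (skip ` U) else skip ` U)"
proof -
  have 1: "\<exists>l\<in>(if i \<in> U then insert j (skip ` U) else skip ` U). d l > 0" if r: "r \<in> U" "merge d r > 0" for r
  proof (cases "r = i")
    case True
    then have "d i > 0 \<or> d j > 0" using r(2) by (auto simp: merge_def not_less) (smt (verit) mult_nonneg_nonpos of_nat_0_le_iff)
    moreover have "i \<in> skip ` U" using r True skip_i by (metis imageI)
    ultimately show ?thesis using True r by auto
  qed (use r in \<open>auto simp: merge_def\<close>)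
  have 2: "\<exists>l\<in>(if i \<in> U then insert j (skip ` U) else skip ` U). d l < 0" if r: "r \<in> U" "merge d r < 0" for r
  proof (cases "r = i")
    case True
    then have "d i < 0 \<or> d j < 0" using r(2) by (auto simp: merge_def not_less) (smt (verit) mult_nonneg_nonneg of_nat_0_le_iff)
    moreover have "i \<in> skip ` U" using r True skip_i by (metis imageI)
    ultimately show ?thesis using True r by auto
  qed (use r in \<open>auto simp: merge_def\<close>)
  show ?thesis using assms 1 2 unfolding mixed_def by blast
qed

text \<open>If \<open>i\<close> lies in \<open>U\<close>, the corresponding columns of the old
  matrix are one more than those in \<open>U\<close>, but \<open>d1\<close> is mixed on them and is
  left out of the new family, so the strict inequality persists.\<close>

lemma dominating_merge:
  assumes D: "finite D" "dominating n D" and d1: "d1 \<in> D" "d1 i > 0" "d1 j < 0"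
  shows "dominating (n - 1) (merge ` (D - {d1}))"
  unfolding dominating_def
proof (intro allI impI)
  fix U assume U: "U \<subseteq> {..<n - 1}" "U \<noteq> {}"
  have finU: "finite U" using U finite_subset by blast
  let ?T = "{d\<in>D - {d1}. mixed (merge d) U}"
  let ?V = "if i \<in> U then insert j (skip ` U) else skip ` U"
  let ?TV = "{d\<in>D. mixed d ?V}"
  have "{d\<in>merge ` (D - {d1}). mixed d U} = merge ` ?T" by auto
  then have 1: "card {d\<in>merge ` (D - {d1}). mixed d U} \<le> card ?T"
    using D(1) card_image_le[of ?T merge] by simp
  have sub: "?T \<subseteq> ?TV" using mixed_merge by blast
  have V: "?V \<subseteq> {..<n}" "?V \<noteq> {}" using U skip_less ij by auto
  have TV: "card ?TV < card ?V" using D(2) V unfolding dominating_def by blast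
  have cs: "card (skip ` U) = card U" by (simp add: card_image inj_on_subset[OF inj_skip])
  show "card {d\<in>merge ` (D - {d1}). mixed d U} < card U"
  proof (cases "i \<in> U")
    case True
    have "i \<in> skip ` U" using True skip_i by (metis imageI)
    then have "d1 \<in> ?TV" using True d1 by (auto simp: mixed_def)
    then have "insert d1 ?T \<subseteq> ?TV" using sub by blast
    then have "card (insert d1 ?T) \<le> card ?TV" using D(1) by (intro card_mono) auto
    moreover have "card (insert d1 ?T) = Suc (card ?T)" using D(1) by (subst card_insert_disjoint) auto
    moreover have "j \<notin> skip ` U" by (metis imageE skip_neq_j)
    then have "card ?V = Suc (card U)" using True finU cs by simp
    ultimately show ?thesis using 1 TV by linarith
  next
    case False
    have "card ?T \<le> card ?TV" using D(1) sub by (intro card_mono) auto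
    then show ?thesis using 1 TV False cs by simp
  qed
qed

text \<open>Bezout coefficients of \<open>p\<close> and \<open>q\<close> split the entry at
  \<open>i\<close>; the other entries are copied, shifted by one beyond \<open>j\<close>.\<close>

lemma merge_lift:
  assumes "\<And>l. l \<ge> n - 1 \<Longrightarrow> z l = 0"
  shows "\<exists>y. merge y = z"
proof -
  obtain a b where ab: "a * int p + b * int q = 1"
    using coprime_pq bezout_int[of "int p" "int q"] by (auto simp: coprime_iff_gcd_eq_1)
  define y where "y s = (if s = i then a * z i else if s = j then b * z i else if s < j then z s else z (s - 1))" for s
  have "int p * (a * z i) + int q * (b * z i) = z i * (a * int p + b * int q)" by (simp add: algebra_simps)
  then have "merge y r = z r" for r
    using ij ab by (auto simp: merge_def y_def skip_def)
  then show ?thesis by blast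
qed

text \<open>A relation of \<open>A'\<close> lifts to one of \<open>A\<close>, which expands in the
  old differences; merging the expansion drops the term of \<open>d1\<close>. So the merged rows
  span, and domination turns spanning into walks.\<close>

lemma gens_merge:
  assumes B: "finite B" "gens B" and D: "dominating n (dif ` B)"
    and d1: "d1 \<in> dif ` B" "d1 i > 0" "d1 j < 0" "merge d1 = (\<lambda>_. 0)"
  shows "M.gens (part_pairs (n - 1) (merge ` (dif ` B - {d1})))"
proof -
  let ?D = "merge ` (dif ` B - {d1})"
  have zero: "d l = 0" if d: "d \<in> ?D" "l \<ge> n - 1" for d l
  proof -
    obtain e where e: "e \<in> dif ` B" "d = merge e" using d(1) by blast
    have "l \<noteq> i" "skip l \<ge> n" using ij d(2) by (auto simp: skip_def)
    then show ?thesis using gens_dif(2)[OF B(2) e(1)] e(2) by (simp add: merge_def)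
  qed
  have kr: "M.ker d" if "d \<in> ?D" for d using that gens_dif(1)[OF B(2)] ker_merge by auto
  have finD: "finite ?D" using B(1) by simp
  have dom: "dominating (n - 1) ?D" using dominating_merge[OF _ D d1(1-3)] B(1) by simp
  have "conn (part_pairs (n - 1) ?D) u v" if uv: "u \<in> mons (n - 1)" "v \<in> mons (n - 1)" "M.E u = M.E v" for u v
  proof -
    have z0: "dif (u, v) l = 0" if "l \<ge> n - 1" for l using uv that by (simp add: dif_def mons_iff)
    obtain y where y: "merge y = dif (u, v)" using merge_lift[of "dif (u, v)"] z0 by blast
    have "ker y" using uv(3) M.E_eq_iff_ker ker_merge y by metis
    then obtain c :: "(nat \<Rightarrow> int) \<Rightarrow> int" where c: "\<And>l. l < n \<Longrightarrow> y l = (\<Sum>d\<in>dif ` B. c d * d l)"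
      using gens_span[OF B] by blast
    \<comment> \<open>Different rows may merge to the same vector, so the coefficients are added
      over each preimage.\<close>
    let ?c = "\<lambda>d'. \<Sum>d\<in>{d \<in> dif ` B - {d1}. merge d = d'}. c d"
    have "dif (u, v) l = (\<Sum>d\<in>?D. ?c d * d l)" for l
    proof (cases "l < n - 1")
      case True
      have "dif (u, v) l = (\<Sum>d\<in>dif ` B. c d * merge d l)"
      proof (cases "l = i")
        case True
        then show ?thesis using c[of i] c[of j] ij
          unfolding y[symmetric] by (simp add: merge_def sum_distrib_left sum.distrib[symmetric] algebra_simps)
      next
        case False
        then show ?thesis using c[OF skip_less[OF True]] unfolding y[symmetric] by (simp add: merge_def)
      qed
      also have "\<dots> = (\<Sum>d\<in>dif ` B - {d1}. c d * merge d l)"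
        using B(1) d1(1,4) by (subst sum.remove[of _ d1]) auto
      also have "\<dots> = (\<Sum>d'\<in>?D. \<Sum>d\<in>{d \<in> dif ` B - {d1}. merge d = d'}. c d * merge d l)"
        using B(1) by (intro sum.image_gen) simp
      also have "\<dots> = (\<Sum>d\<in>?D. ?c d * d l)"
        by (intro sum.cong) (auto simp: sum_distrib_right)
      finally show ?thesis .
    next
      case False
      then have "d l = 0" if "d \<in> ?D" for d using zero[OF that, of l] by simp
      then have "(\<Sum>d\<in>?D. ?c d * d l) = (\<Sum>d\<in>?D. ?c d * 0)" by (intro sum.cong refl) simp
      then show ?thesis using z0[of l] False by simp
    qed
    then show ?thesis using finD dom zero by (intro dominating_conn[where c = ?c])
  qed
  moreover have "\<forall>(a, b)\<in>part_pairs (n - 1) ?D. a \<in> mons (n - 1) \<and> b \<in> mons (n - 1) \<and> M.E a = M.E b"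
    using kr M.E_parts unfolding part_pairs_def by auto
  ultimately show ?thesis by (simp add: M.gens_def)
qed

end

lemma moves_part_pairs_cases:
  assumes "moves (part_pairs n D) u v"
  obtains d w where "d \<in> D \<or> (\<lambda>l. - d l) \<in> D" "u = pos_part n d + w" "v = neg_part n d + w"
proof -
  obtain a b w where ab: "(a, b) \<in> part_pairs n D \<or> (b, a) \<in> part_pairs n D" "u = a + w" "v = b + w"
    using assms by (auto simp: moves_def)
  from ab(1) show ?thesis
  proof
    assume "(a, b) \<in> part_pairs n D"
    then obtain d where "d \<in> D" "a = pos_part n d" "b = neg_part n d" by (auto simp: part_pairs_def)
    then show ?thesis using that[of d w] ab by simp
  next
    assume "(b, a) \<in> part_pairs n D"
    then obtain d where d: "d \<in> D" "b = pos_part n d" "a = neg_part n d" by (auto simp: part_pairs_def)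
    have "pos_part n (\<lambda>l. - d l) = a" "neg_part n (\<lambda>l. - d l) = b"
      using d by (simp_all add: pos_part_def neg_part_def)
    then show ?thesis using that[of "\<lambda>l. - d l" w] ab d(1) by simp
  qed
qed

section \<open>Comparing the minimal multiples of \<open>A\<close> and \<open>A'\<close>\<close>

context merging begin

abbreviation relation :: "nat \<Rightarrow> nat \<Rightarrow> bool" where
  "relation r b \<equiv> \<exists>z. ker z \<and> z r = int b \<and> (\<forall>t. t \<noteq> r \<longrightarrow> z t \<le> 0)"

abbreviation relation' :: "nat \<Rightarrow> nat \<Rightarrow> bool" where
  "relation' r b \<equiv> \<exists>z. M.ker z \<and> z r = int b \<and> (\<forall>t. t \<noteq> r \<longrightarrow> z t \<le> 0)"

text \<open>Nonpositive entries at \<open>i\<close> and \<open>j\<close> merge to a nonpositive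
  entry, so every multiple admissible for \<open>A\<close> is admissible for
  \<open>A'\<close>.\<close>

lemma relation_merge:
  assumes r: "r \<noteq> i" and rel: "relation (skip r) b"
  shows "relation' r b"
proof -
  obtain z where z: "ker z" "z (skip r) = int b" "\<And>t. t \<noteq> skip r \<Longrightarrow> z t \<le> 0" using rel by blast
  have "i \<noteq> skip r" "j \<noteq> skip r" using r skip_i skip_neq_j by metis+
  then have "z i \<le> 0" "z j \<le> 0" using z(3) by auto
  then have "merge z i \<le> 0" by (simp add: merge_def add_nonpos_nonpos mult_nonneg_nonpos)
  moreover have "merge z t \<le> 0" if "t \<noteq> i" "t \<noteq> r" for t
    using that z(3)[of "skip t"] inj_skip by (simp add: merge_def inj_eq)
  ultimately have "\<forall>t. t \<noteq> r \<longrightarrow> merge z t \<le> 0" by metis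
  then show ?thesis using z(1,2) r ker_merge by (intro exI[of _ "merge z"]) (simp add: merge_def)
qed

text \<open>A proper move out of the pure power x_r^b uses a generator whose positive part is a
  power of x_r, and minimality of \<open>b\<close> forces the full power. Its row \<open>e\<close>
  in the old matrix is not mixed on \<open>{i, j}\<close> while p e_i + q e_j is nonpositive, hence
  both entries are nonpositive and \<open>e\<close> is the required relation.\<close>

lemma least_relation_lift:
  assumes B: "finite B" "gens B" and D: "dominating n (dif ` B)"
    and d1: "d1 \<in> dif ` B" "d1 i > 0" "d1 j < 0" "merge d1 = (\<lambda>_. 0)"
    and r: "r < n - 1" "r \<noteq> i" and b: "b > 0" "relation' r b"
    and min: "\<And>c. 0 < c \<Longrightarrow> c < b \<Longrightarrow> \<not> relation' r c"
  shows "relation (skip r) b"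
proof -
  let ?D = "merge ` (dif ` B - {d1})"
  let ?P = "part_pairs (n - 1) ?D"
  obtain z where z: "M.ker z" "z r = int b" "\<And>t. t \<noteq> r \<Longrightarrow> z t \<le> 0" using b(2) by blast
  let ?u = "pos_part (n - 1) z"
  have u: "Poly_Mapping.lookup ?u t = (if t = r then b else 0)" for t
    using z(2) z(3)[of t] r(1) by (auto simp: pos_part_def lookup_mon)
  have "M.E ?u = M.E (neg_part (n - 1) z)" using M.E_parts[OF z(1)] by simp
  then have "conn ?P ?u (neg_part (n - 1) z)"
    using gens_merge[OF B D d1] by (simp add: M.gens_def)
  moreover have "neg_part (n - 1) z \<noteq> ?u"
  proof
    assume "neg_part (n - 1) z = ?u"
    then have "Poly_Mapping.lookup (neg_part (n - 1) z) r = b" using u[of r] by simp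
    then show False using z(2) b(1) r(1) by (simp add: neg_part_def lookup_mon)
  qed
  ultimately obtain v where v: "moves ?P ?u v" "v \<noteq> ?u" using conn_isolated by blast
  obtain d w where d: "d \<in> ?D \<or> (\<lambda>l. - d l) \<in> ?D" and dw: "?u = pos_part (n - 1) d + w" "v = neg_part (n - 1) d + w"
    using moves_part_pairs_cases[OF v(1)] by blast
  obtain e where e: "e \<in> dif ` B - {d1} \<or> (\<lambda>l. - e l) \<in> dif ` B - {d1}" "d = merge e"
  proof -
    from d show ?thesis
    proof
      assume "d \<in> ?D"
      then show ?thesis using that by blast
    next
      assume "(\<lambda>l. - d l) \<in> ?D"
      then obtain e where e: "e \<in> dif ` B - {d1}" "(\<lambda>l. - d l) = merge e" by blast
      have "d l = merge (\<lambda>l. - e l) l" for l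
      proof -
        have "d l = - merge e l" using fun_cong[OF e(2), of l] by linarith
        then show ?thesis by (simp add: merge_def)
      qed
      then have "d = merge (\<lambda>l. - e l)" by (rule ext)
      then show ?thesis using that[of "\<lambda>l. - e l"] e(1) by simp
    qed
  qed
  have ke: "ker e" using e(1) gens_dif(1)[OF B(2)] ker_uminus[of "\<lambda>l. - e l"] by auto
  have ez: "e l = 0" if "l \<ge> n" for l
    using e(1) gens_dif(2)[OF B(2), of e l] gens_dif(2)[OF B(2), of "\<lambda>l. - e l" l] that by auto
  have kd: "M.ker d" using ke ker_merge e(2) by simp
  have le: "nat (d t) \<le> (if t = r then b else 0)" if "t < n - 1" for t
  proof -
    have "Poly_Mapping.lookup ?u t = Poly_Mapping.lookup (pos_part (n - 1) d) t + Poly_Mapping.lookup w t"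
      by (subst dw(1)) (simp add: lookup_add)
    then show ?thesis using that unfolding u by (simp add: pos_part_def lookup_mon)
  qed
  have neg: "d t \<le> 0" if "t \<noteq> r" for t
  proof (cases "t < n - 1")
    case True
    then show ?thesis using le[of t] that by simp
  next
    case False
    then have "t \<noteq> i" "skip t \<ge> n" using ij by (auto simp: skip_def)
    then show ?thesis using ez e(2) by (simp add: merge_def)
  qed
  \<comment> \<open>Otherwise \<open>d\<close> vanishes by pointedness and the move would be
    trivial.\<close>
  have "d r > 0"
  proof (rule ccontr)
    assume "\<not> d r > 0"
    then have "d t \<le> 0" for t using neg[of t] by (cases "t = r") auto
    then have "d t = 0" if "t < n - 1" for t using M.ker_nonpos_zero[OF kd, of t] that by simp
    then have "pos_part (n - 1) d = neg_part (n - 1) d"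
      by (intro poly_mapping_eqI) (simp add: pos_part_def neg_part_def lookup_mon)
    then show False using dw v(2) by simp
  qed
  then have "relation' r (nat (d r))" using kd neg by (intro exI[of _ d]) simp
  then have "\<not> nat (d r) < b" using min[of "nat (d r)"] \<open>d r > 0\<close> by auto
  then have dr: "d r = int b" using le[OF r(1)] \<open>d r > 0\<close> by simp
  \<comment> \<open>Otherwise \<open>e\<close> and \<open>d1\<close> would both be mixed on the two columns \<open>i\<close> and \<open>j\<close>.\<close>
  have nm: "\<not> mixed e {i, j}"
  proof
    assume me: "mixed e {i, j}"
    define e' where "e' = (if e \<in> dif ` B - {d1} then e else (\<lambda>l. - e l))"
    have e': "e' \<in> dif ` B - {d1}" "mixed e' {i, j}"
      using e(1) me by (auto simp: e'_def mixed_uminus)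
    have "mixed d1 {i, j}" using d1 by (auto simp: mixed_def)
    then have "{d1, e'} \<subseteq> {d\<in>dif ` B. mixed d {i, j}}" using d1(1) e' by auto
    then have "card {d1, e'} \<le> card {d\<in>dif ` B. mixed d {i, j}}" using B(1) by (intro card_mono) auto
    also have "\<dots> < card {i, j}" 
      using D[unfolded dominating_def, rule_format, of "{i, j}"] ij by (simp del: card_insert_disjoint)
    finally show False using e'(1) ij by auto
  qed
  have sum: "int p * e i + int q * e j \<le> 0" using neg[of i] r(2) e(2) by (simp add: merge_def)
  have "e i \<le> 0 \<and> e j \<le> 0"
  proof (rule ccontr)
    assume "\<not> ?thesis"
    then consider "e i > 0" | "e j > 0" by linarith
    then show False
    proof cases
      case 1
      then have "int p * e i > 0" using pq_pos by simp
      then have "int q * e j < 0" using sum by linarith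
      then have "e j < 0" using pq_pos by (simp add: mult_less_0_iff)
      then show False using 1 nm by (auto simp: mixed_def)
    next
      case 2
      then have "int q * e j > 0" using pq_pos by simp
      then have "int p * e i < 0" using sum by linarith
      then have "e i < 0" using pq_pos by (simp add: mult_less_0_iff)
      then show False using 2 nm by (auto simp: mixed_def)
    qed
  qed
  moreover have "e t \<le> 0" if t: "t \<noteq> skip r" "t \<noteq> i" "t \<noteq> j" for t
  proof -
    obtain s where s: "skip s = t" using skip_surj[OF t(3)] by blast
    then have "s \<noteq> r" "s \<noteq> i" using t skip_i by auto
    then show ?thesis using neg[of s] e(2) s by (simp add: merge_def)
  qed
  ultimately have "\<forall>t. t \<noteq> skip r \<longrightarrow> e t \<le> 0" by metis
  moreover have "e (skip r) = int b" using dr e(2) r(2) by (simp add: merge_def)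
  ultimately show ?thesis using ke by blast
qed

lemma mult_m_merge:
  assumes B: "finite B" "gens B" and D: "dominating n (dif ` B)"
    and d1: "d1 \<in> dif ` B" "d1 i > 0" "d1 j < 0" "merge d1 = (\<lambda>_. 0)"
    and r: "r < n - 1" "r \<noteq> i"
  shows "mult_m m A' r = mult_m m A (skip r)"
proof -
  let ?P = "\<lambda>b. b > 0 \<and> relation (skip r) b" and ?P' = "\<lambda>b. b > 0 \<and> relation' r b"
  have imp: "?P' b" if "?P b" for b using that relation_merge[OF r(2)] by blast
  have "(LEAST b. ?P' b) = (LEAST b. ?P b)"
  proof (cases "\<exists>b. ?P' b")
    case True
    then have L: "?P' (LEAST b. ?P' b)" by (rule LeastI_ex)
    have "\<not> relation' r c" if "0 < c" "c < (LEAST b. ?P' b)" for c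
      using not_less_Least[OF that(2)] that(1) by blast
    then have "?P (LEAST b. ?P' b)"
      using least_relation_lift[OF B D d1 r] L by blast
    then have "(LEAST b. ?P b) = (LEAST b. ?P' b)"
    proof (rule Least_equality)
      fix b assume "?P b"
      then have "?P' b" by (rule imp)
      then show "(LEAST b. ?P' b) \<le> b" by (rule Least_le)
    qed
    then show ?thesis by simp
  next
    case False
    \<comment> \<open>Neither predicate has a witness, so they coincide and their
      \<open>LEAST\<close> terms agree.\<close>
    then have "?P' b = ?P b" for b using imp[of b] by metis
    then show ?thesis by presburger
  qed
  then show ?thesis
    using mult_m_eq[OF skip_less[OF r(1)]] M.mult_m_eq[of r] r(1) by simp
qed

end

lemma (in toric) mult_m_in_cone:
  assumes "i < n" "in_cone m A i"
  shows "mult_m m A i > 0"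
    and "\<And>c z. 0 < c \<Longrightarrow> ker z \<Longrightarrow> z i = int c \<Longrightarrow> (\<And>t. t \<noteq> i \<Longrightarrow> z t \<le> 0) \<Longrightarrow> mult_m m A i \<le> c"
proof -
  let ?P = "\<lambda>b. b > 0 \<and> (\<exists>z. ker z \<and> z i = int b \<and> (\<forall>t. t \<noteq> i \<longrightarrow> z t \<le> 0))"
  have eq: "mult_m m A i = (LEAST b. ?P b)" by (rule mult_m_eq[OF assms(1)])
  have "\<exists>b. ?P b" using in_cone_relation[OF assms] .
  then have "?P (LEAST b. ?P b)" by (rule LeastI_ex)
  then show "mult_m m A i > 0" using eq by simp
  show "mult_m m A i \<le> c" if "0 < c" "ker z" "z i = int c" "\<And>t. t \<noteq> i \<Longrightarrow> z t \<le> 0" for c z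
    unfolding eq by (rule Least_le) (use that in blast)
qed

theorem mainTheorem8:
  fixes A :: "nat list list" and m i j :: nat
  assumes vecs: "\<forall>v\<in>set A. length v = m \<and> v \<noteq> replicate m 0"
    and CI: "toric_CI TYPE('k::field) m A"
    and ij: "i < j" "j < length A"
    and cone_i: "in_cone m A i" and cone_j: "in_cone m A j"
    and eq: "map ((*) (mult_m m A i)) (A!i) = map ((*) (mult_m m A j)) (A!j)"
  shows "toric_CI TYPE('k) m (merge_list A i j) \<and>
         (\<forall>r < length A - 1. in_cone m (merge_list A i j) r \<longrightarrow>
             ((r < j \<and> r \<noteq> i \<longrightarrow> mult_m m (merge_list A i j) r = mult_m m A r) \<and>
              (j \<le> r \<longrightarrow> mult_m m (merge_list A i j) r = mult_m m A (Suc r))))"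
proof -
  interpret toric m A using vecs by unfold_locales
  define q where "q = mult_m m A i"
  define p where "p = mult_m m A j"
  have i: "i < n" using ij by simp
  have q: "q > 0" "\<And>c z. 0 < c \<Longrightarrow> ker z \<Longrightarrow> z i = int c \<Longrightarrow> (\<And>t. t \<noteq> i \<Longrightarrow> z t \<le> 0) \<Longrightarrow> q \<le> c"
    unfolding q_def using mult_m_in_cone[OF i cone_i] by blast+
  have p: "p > 0" "\<And>c z. 0 < c \<Longrightarrow> ker z \<Longrightarrow> z j = int c \<Longrightarrow> (\<And>t. t \<noteq> j \<Longrightarrow> z t \<le> 0) \<Longrightarrow> p \<le> c"
    unfolding p_def using mult_m_in_cone[OF ij(2) cone_j] by blast+
  have proportional: "q * (A!i!l) = p * (A!j!l)" if "l < m" for l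
    using arg_cong[OF eq, of "\<lambda>v. v!l"] that length_nth[OF i] length_nth[OF ij(2)] by (simp add: p_def q_def)
  have ker_row: "ker (\<lambda>t. if t = i then int a else if t = j then - int b else 0)"
    if ab: "\<And>l. l < m \<Longrightarrow> a * (A!i!l) = b * (A!j!l)" for a b
  proof -
    have "(\<Sum>t<n. (if t = i then int a else if t = j then - int b else 0) * int (A!t!l)) = 0" if "l < m" for l
    proof -
      have "(\<Sum>t<n. (if t = i then int a else if t = j then - int b else 0) * int (A!t!l))
          = (\<Sum>t\<in>{i, j}. (if t = i then int a else if t = j then - int b else 0) * int (A!t!l))"
        using ij by (intro sum.mono_neutral_right) auto
      also have "\<dots> = int (a * (A!i!l)) - int (b * (A!j!l))" using ij by simp
      finally show ?thesis using ab[OF that] by simp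
    qed
    then show ?thesis by (simp add: ker_def)
  qed
  \<comment> \<open>Dividing q a_i = p a_j by a common factor larger than 1 would give a multiple of
    a_i smaller than the minimal one.\<close>
  have "coprime p q"
  proof -
    define g where "g = gcd p q"
    have g: "g > 0" "g dvd p" "g dvd q" using p(1) by (auto simp: g_def)
    have "q div g * (A!i!l) = p div g * (A!j!l)" if "l < m" for l
    proof -
      have "g * (q div g * (A!i!l)) = g * (p div g * (A!j!l))"
        using proportional[OF that] g by (simp flip: mult.assoc)
      then show ?thesis using g(1) by simp
    qed
    then have "ker (\<lambda>t. if t = i then int (q div g) else if t = j then - int (p div g) else 0)" by (rule ker_row)
    moreover have "q div g > 0" using q(1) g by (simp add: div_greater_zero_iff dvd_imp_le)
    ultimately have "q \<le> q div g" using q(2)[of "q div g"] by fastforce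
    then have "\<not> 1 < g" using div_less_dividend[of g q] q(1) by linarith
    then have "g = 1" using g(1) by linarith
    then show ?thesis unfolding g_def coprime_iff_gcd_eq_1 .
  qed
  then interpret merging m A i j p q
    using ij p(1) q(1) proportional by unfold_locales
  obtain G :: "'k mpoly set" where G: "finite G" "G \<subseteq> poly_ring n" "card G = n - lattice_rank m A"
      "gen_ideal n G = toric_ideal A"
    using toric_CI_D[OF CI] by blast
  let ?u = "Poly_Mapping.single i q" and ?v = "Poly_Mapping.single j p"
  define d1 where "d1 = dif (?u, ?v)"
  have d1_eq: "d1 = (\<lambda>t. if t = i then int q else if t = j then - int p else 0)"
    using ij by (intro ext) (auto simp: d1_def dif_def lookup_single when_def)
  have "isolated ?u"
    using q(2) by (intro isolated_single[OF i]) (metis not_le)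
  moreover have "isolated ?v"
    using p(2) by (intro isolated_single[OF ij(2)]) (metis not_le)
  moreover have "E ?u = E ?v"
    unfolding E_eq_iff_ker d1_def[symmetric] d1_eq using ker_row proportional by blast
  moreover have "?u \<noteq> ?v"
  proof
    assume "?u = ?v"
    then have "d1 i = 0" by (simp add: d1_def dif_def)
    then show False using q(1) by (simp add: d1_eq)
  qed
  ultimately obtain B where B: "finite B" "gens B" "card B \<le> n - lattice_rank m A" "(?u, ?v) \<in> B"
    using gens_of_ideal_generators[OF G(1,4), of ?u ?v] G(3) by auto
  have D: "dominating n (dif ` B)" using dominating_of_minimal_gens[OF B(1-3)] .
  have d1: "d1 \<in> dif ` B" "d1 i > 0" "d1 j < 0" "merge d1 = (\<lambda>_. 0)"
  proof -
    show "d1 \<in> dif ` B" using B(4) by (simp add: d1_def)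
    show "d1 i > 0" "d1 j < 0" using ij p(1) q(1) by (auto simp: d1_eq)
    \<comment> \<open>The merged entry is p q - q p.\<close>
    show "merge d1 = (\<lambda>_. 0)" using ij by (intro ext) (simp add: merge_def d1_eq)
  qed
  let ?D = "merge ` (dif ` B - {d1})"
  have "card (part_pairs (n - 1) ?D) \<le> card (dif ` B - {d1})"
    unfolding part_pairs_def using B(1) by (meson card_image_le finite_Diff finite_imageI order.trans)
  \<comment> \<open>Deleting \<open>d1\<close> saves one generator, which matches the drop of the
    height by one.\<close>
  also have "\<dots> = card (dif ` B) - 1" using d1(1) by simp
  also have "\<dots> \<le> length A' - lattice_rank m A'"
    using B(3) card_image_le[OF B(1), of dif] by (simp add: lattice_rank_merge)
  finally have "toric_CI TYPE('k) m A'"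
    using gens_merge[OF B(1,2) D d1] B(1) by (intro M.toric_CI_I) (auto simp: part_pairs_def)
  moreover have "mult_m m A' r = mult_m m A (skip r)" if "r < n - 1" "r \<noteq> i" for r
    using mult_m_merge[OF B(1,2) D d1 that] .
  ultimately show ?thesis using ij by (auto simp: skip_def)
qed

end
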